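(* Let $g',d'\in\mathbb N$. If $h:\mathcal B_{g'}\to\mathcal B_{d'}$ is an NC ball map with $h(0)=0$, then $h$ is linear and there is a unique isometry $M\in\mathbb C^{d'\times g'}$ such that $h=Mx$, i.e. $h(X)=(M\otimes I_N)X$ for all $N$ and all $X\in\operatorname{int}\mathcal B_{g'}$ of size $N$. In particular, if $d'<g'$ then no such NC ball maps exist.
   Context: For $N\in\mathbb N$, $\mathcal M_{d'\times d}(N)$ is the set of $d'\times d$ block matrices $X=[X_{j\ell}]$ with $X_{j\ell}\in\mathbb C^{N\times N}$, regarded as $d'N\times dN$ matrices with the operator norm; $\mathcal M_{d'\times d}=\bigsqcup_N\mathcal M_{d'\times d}(N)$. Put $\mathcal B_{d'\times d}=\{X\in\mathcal M_{d'\times d}:\|X\|\le1\}$, $\operatorname{int}\mathcal B_{d'\times d}=\{X\in\mathcal M_{d'\times d}:\|X\|<1\}$ and $\mathcal B_{g'}=\mathcal B_{g'\times1}$ (columns of $g'$ square matrices). NC analytic functions: let $x=(x_1,\dots,x_{g'})$ be noncommuting variables (viewed as a column) and $\langle x\rangle$ the set of words in them; $w(X)\in\mathbb C^{N\times N}$ is the evaluation of the word $w$ at $X=(X_1,\dots,X_{g'})$, $X_j\in\mathbb C^{N\times N}$. An NC analytic function $f:\mathcal B_{g'}\to\mathcal M_{d'\times d}$ assigns to each $X\in\operatorname{int}\mathcal B_{g'}$ of size $N$ a matrix $f(X)\in\mathcal M_{d'\times d}(N)$, such that: (1) there are $a_w\in\mathbb C^{d'\times d}$ and $\varepsilon>0$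 such that for all $N$ and all $X$ of size $N$ with $\|X\|<\varepsilon$, $f(X)=\sum_{\alpha=0}^\infty\sum_{|w|=\alpha}a_w\otimes w(X)$, the outer sum converging; (2) for every analytic $a$ from a domain $W\subseteq\mathbb C^K$ into $\operatorname{int}\mathcal B_{g'}$ (at a fixed size), $f\circ a$ is analytic on $W$, and continuous up to $\partial W$ whenever $a$ extends continuously to $\overline W$ with values in $\operatorname{int}\mathcal B_{g'}$. For $\|X\|=1$ and $t\in\mathbb R$, $f(e^{it}X)$ denotes $\lim_{r\nearrow1}f(re^{it}X)$ when this limit exists. An NC ball map $f:\mathcal B_{g'}\to\mathcal B_{d'}$ is an NC analytic function (with $d=1$) with values in $\mathcal B_{d'}$ such that $\|f(e^{it}X)\|=1$ whenever $\|X\|=1$ and $f(e^{it}X)$ exists. *)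

theory Defs
  imports "HOL-Analysis.Analysis" "Jordan_Normal_Form.Matrix"
begin

no_notation vec_nth (infixl \<open>$\<close> 90)

definition l2_norm_vec :: "complex vec \<Rightarrow> real" where
  "l2_norm_vec v = L2_set (\<lambda>i. cmod (v $ i)) {..<dim_vec v}"

definition op_norm :: "complex mat \<Rightarrow> real" where
  "op_norm A =
     (SUP v\<in>{v \<in> carrier_vec (dim_col A). l2_norm_vec v \<le> 1}. l2_norm_vec (A *\<^sub>v v))"

definition isometry_mat :: "complex mat \<Rightarrow> bool" where
  "isometry_mat A \<longleftrightarrow> (\<forall>v\<in>carrier_vec (dim_col A). l2_norm_vec (A *\<^sub>v v) = l2_norm_vec v)"

definition kron :: "complex mat \<Rightarrow> complex mat \<Rightarrow> complex mat" where
  "kron A B = mat (dim_row A * dim_row B) (dim_col A * dim_col B)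
     (\<lambda>(i, j). A $$ (i div dim_row B, j div dim_col B) * B $$ (i mod dim_row B, j mod dim_col B))"

text \<open>
  A block matrix with \<open>m\<close> by \<open>d\<close> blocks of size \<open>N\<close> is represented by the ordinary
  \<open>m * N\<close> by \<open>d * N\<close> matrix. As all blocks are nonempty (\<open>0 < N\<close>), for fixed positive
  \<open>m\<close> and \<open>d\<close> the size \<open>N\<close> is determined by the matrix, so that a function on the disjoint
  union over all \<open>N\<close> is a function of the matrix alone.
\<close>

definition block_mats :: "nat \<Rightarrow> nat \<Rightarrow> nat \<Rightarrow> complex mat set" where
  "block_mats m d N = carrier_mat (m * N) (d * N)"

definition block :: "nat \<Rightarrow> complex mat \<Rightarrow> nat \<Rightarrow> nat \<Rightarrow> complex mat" where
  "block N X j l = mat N N (\<lambda>(i, k). X $$ (j * N + i, l * N + k))"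

definition nc_ball :: "nat \<Rightarrow> nat \<Rightarrow> nat \<Rightarrow> complex mat set" where
  "nc_ball m d N = {X \<in> block_mats m d N. op_norm X \<le> 1}"

definition int_nc_ball :: "nat \<Rightarrow> nat \<Rightarrow> nat \<Rightarrow> complex mat set" where
  "int_nc_ball m d N = {X \<in> block_mats m d N. op_norm X < 1}"

text \<open>Words in the variables \<open>x\<^sub>0, \<dots>, x\<^bsub>g-1\<^esub>\<close> are lists of indices.\<close>

definition words :: "nat \<Rightarrow> nat \<Rightarrow> nat list set" where
  "words g \<alpha> = {w. set w \<subseteq> {..<g} \<and> length w = \<alpha>}"

fun word_eval :: "nat \<Rightarrow> complex mat \<Rightarrow> nat list \<Rightarrow> complex mat" where
  "word_eval N X [] = 1\<^sub>m N"
| "word_eval N X (j # w) = block N X j 0 * word_eval N X w"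

text \<open>
  The type of matrices of all sizes carries no topology; limits and continuity of matrices
  of a fixed size are entrywise.
\<close>

definition mat_tendsto ::
    "nat \<Rightarrow> nat \<Rightarrow> ('a \<Rightarrow> complex mat) \<Rightarrow> complex mat \<Rightarrow> 'a filter \<Rightarrow> bool" where
  "mat_tendsto m n F L \<F> \<longleftrightarrow>
     (\<forall>i<m. \<forall>j<n. ((\<lambda>x. F x $$ (i, j)) \<longlongrightarrow> L $$ (i, j)) \<F>)"

definition mat_continuous_on ::
    "nat \<Rightarrow> nat \<Rightarrow> ('a::topological_space) set \<Rightarrow> ('a \<Rightarrow> complex mat) \<Rightarrow> bool" where
  "mat_continuous_on m n S F \<longleftrightarrow> (\<forall>i<m. \<forall>j<n. continuous_on S (\<lambda>x. F x $$ (i, j)))"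

text \<open>
  The dimension of \<open>\<complex>\<^sup>K\<close> is quantified inside the definition of an NC analytic function, so
  \<open>\<complex>\<^sup>K\<close> is the set of sequences vanishing from index \<open>K\<close> on. It is closed in the product
  topology, and the topology it inherits is the Euclidean one.
\<close>

definition complex_space :: "nat \<Rightarrow> (nat \<Rightarrow> complex) set" where
  "complex_space K = {z. \<forall>i\<ge>K. z i = 0}"

definition complex_domain :: "nat \<Rightarrow> (nat \<Rightarrow> complex) set \<Rightarrow> bool" where
  "complex_domain K W \<longleftrightarrow>
     openin (top_of_set (complex_space K)) W \<and> connected W \<and> W \<noteq> {}"

text \<open>
  Local expansion into an (unconditionally, hence absolutely, convergent) power series; the
  summation is over the multi-indices with \<open>K\<close> entries.
\<close>

definition multi_analytic_on ::
    "nat \<Rightarrow> (nat \<Rightarrow> complex) set \<Rightarrow> ((nat \<Rightarrow> complex) \<Rightarrow> complex) \<Rightarrow> bool" where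
  "multi_analytic_on K W F \<longleftrightarrow>
     (\<forall>p\<in>W. \<exists>c :: (nat \<Rightarrow> nat) \<Rightarrow> complex. \<exists>r>0. \<forall>z\<in>W. (\<forall>i<K. cmod (z i - p i) < r) \<longrightarrow>
        ((\<lambda>\<mu>. c \<mu> * (\<Prod>i<K. (z i - p i) ^ \<mu> i)) has_sum F z) {\<mu>. \<forall>i\<ge>K. \<mu> i = 0})"

definition mat_analytic_on ::
    "nat \<Rightarrow> nat \<Rightarrow> nat \<Rightarrow> (nat \<Rightarrow> complex) set \<Rightarrow> ((nat \<Rightarrow> complex) \<Rightarrow> complex mat) \<Rightarrow> bool"
  where
  "mat_analytic_on m n K W F \<longleftrightarrow>
     (\<forall>i<m. \<forall>j<n. multi_analytic_on K W (\<lambda>z. F z $$ (i, j)))"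

definition nc_power_series_at_0 :: "nat \<Rightarrow> nat \<Rightarrow> nat \<Rightarrow> (complex mat \<Rightarrow> complex mat) \<Rightarrow> bool"
  where
  "nc_power_series_at_0 g m d f \<longleftrightarrow>
     (\<exists>a :: nat list \<Rightarrow> complex mat. \<exists>\<epsilon>>0.
        (\<forall>w. a w \<in> carrier_mat m d) \<and>
        (\<forall>N>0. \<forall>X\<in>int_nc_ball g 1 N. op_norm X < \<epsilon> \<longrightarrow>
           (\<forall>i<m * N. \<forall>j<d * N.
              (\<lambda>\<alpha>. \<Sum>w\<in>words g \<alpha>. kron (a w) (word_eval N X w) $$ (i, j)) sums (f X $$ (i, j)))))"

text \<open>
  In the second part of the following definition \<open>b\<close> is the continuous extension of \<open>a\<close> to
  the closure of \<open>W\<close>. The values of \<open>f\<close> outside the open balls are irrelevant.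
\<close>

definition nc_analytic :: "nat \<Rightarrow> nat \<Rightarrow> nat \<Rightarrow> (complex mat \<Rightarrow> complex mat) \<Rightarrow> bool" where
  "nc_analytic g m d f \<longleftrightarrow>
     (\<forall>N>0. \<forall>X\<in>int_nc_ball g 1 N. f X \<in> block_mats m d N) \<and>
     nc_power_series_at_0 g m d f \<and>
     (\<forall>K>0. \<forall>W. \<forall>N>0. \<forall>a.
        complex_domain K W \<and> mat_analytic_on (g * N) N K W a \<and> a ` W \<subseteq> int_nc_ball g 1 N \<longrightarrow>
        mat_analytic_on (m * N) (d * N) K W (\<lambda>z. f (a z)) \<and>
        (\<forall>b. (\<forall>z\<in>W. b z = a z) \<and> mat_continuous_on (g * N) N (closure W) b \<and>
             b ` closure W \<subseteq> int_nc_ball g 1 N \<longrightarrow>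
             mat_continuous_on (m * N) (d * N) (closure W) (\<lambda>z. f (b z))))"

text \<open>The radial limit \<open>L\<close> of \<open>f\<close> along \<open>r e\<^sup>i\<^sup>t X\<close> need not exist; nothing is required if it does not.\<close>

definition nc_ball_map :: "nat \<Rightarrow> nat \<Rightarrow> (complex mat \<Rightarrow> complex mat) \<Rightarrow> bool" where
  "nc_ball_map g m f \<longleftrightarrow>
     nc_analytic g m 1 f \<and>
     (\<forall>N>0. \<forall>X\<in>int_nc_ball g 1 N. f X \<in> nc_ball m 1 N) \<and>
     (\<forall>N>0. \<forall>X\<in>block_mats g 1 N. op_norm X = 1 \<longrightarrow>
        (\<forall>t::real. \<forall>L\<in>block_mats m 1 N.
           mat_tendsto (m * N) N (\<lambda>r::real. f ((of_real r * cis t) \<cdot>\<^sub>m X)) L (at_left 1)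
           \<longrightarrow> op_norm L = 1))"

definition vanishes_at_0 :: "nat \<Rightarrow> nat \<Rightarrow> (complex mat \<Rightarrow> complex mat) \<Rightarrow> bool" where
  "vanishes_at_0 g m f \<longleftrightarrow> (\<forall>N>0. f (0\<^sub>m (g * N) N) = 0\<^sub>m (m * N) N)"

definition linear_on_ball :: "nat \<Rightarrow> (complex mat \<Rightarrow> complex mat) \<Rightarrow> bool" where
  "linear_on_ball g f \<longleftrightarrow>
     (\<forall>N>0. \<forall>X\<in>int_nc_ball g 1 N. \<forall>Y\<in>int_nc_ball g 1 N. \<forall>c d :: complex.
        c \<cdot>\<^sub>m X + d \<cdot>\<^sub>m Y \<in> int_nc_ball g 1 N \<longrightarrow>
        f (c \<cdot>\<^sub>m X + d \<cdot>\<^sub>m Y) = c \<cdot>\<^sub>m f X + d \<cdot>\<^sub>m f Y)"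

end

theory Submission
  imports Defs "HOL-Complex_Analysis.Complex_Analysis" "Jordan_Normal_Form.Determinant"
begin

text \<open>
  Let \<open>h\<close> be an NC ball map in \<open>g\<close> variables with \<open>h(0) = 0\<close> and power series coefficients
  \<open>a\<^sub>w\<close> at \<open>0\<close>, and let \<open>M\<close> be the matrix whose columns are the coefficients of the words of
  length \<open>1\<close>. All information is extracted from the one-variable functions \<open>u \<mapsto> h(u X)\<close>, where
  \<open>X\<close> is a fixed column with \<open>\<parallel>X\<parallel> \<le> 1\<close>: they are holomorphic on the unit disc, and their Taylor
  coefficients at \<open>0\<close> are the homogeneous parts of the power series, evaluated at \<open>X\<close>.

  \<^item> \<open>M\<close> is an isometry (\<open>norm_linear_coeff_mult\<close>). For a unit vector \<open>v\<close> take
    \<open>X = v \<otimes> E\<^sub>1\<^sub>2\<close> with the \<open>2\<close> by \<open>2\<close> matrix unit \<open>E\<^sub>1\<^sub>2\<close>. Every word of length at least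
    \<open>2\<close> vanishes at \<open>X\<close>, so \<open>h(u X) = u (M v \<otimes> E\<^sub>1\<^sub>2)\<close>, the radial limit exists, and the
    boundary condition says \<open>\<parallel>M v\<parallel> = 1\<close>.

  \<^item> \<open>a\<^sub>w = 0\<close> for every word \<open>w\<close> of length \<open>n \<ge> 2\<close> (\<open>coeff_eq_0\<close>). Take for \<open>X\<close> a column
    isometry of size \<open>n + 1\<close> in which \<open>w\<close> is encoded: the component of \<open>X\<close> indexed by the
    \<open>k\<close>-th letter of \<open>w\<close> sends the basis vector \<open>e\<^bsub>k+1\<^esub>\<close> to \<open>e\<^sub>k\<close>, and one component sends
    \<open>e\<^sub>0\<close> to \<open>e\<^sub>n\<close>. The vector function \<open>F(u) = h(u X) e\<^sub>n\<close> is bounded by \<open>1\<close>, vanishes at \<open>0\<close>, and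
    \<open>\<parallel>F'(0)\<parallel> = \<parallel>(M \<otimes> I) X e\<^sub>n\<parallel> = 1\<close> because \<open>M\<close> and \<open>X\<close> are isometric. The equality case of
    the Schwarz lemma (\<open>schwarz_lemma_vector\<close>) gives \<open>F(u) = u F'(0)\<close>, so the higher Taylor
    coefficients of \<open>F\<close> vanish. Among the words of length \<open>n\<close> only \<open>w\<close> maps \<open>e\<^sub>n\<close> to a vector
    with a nonzero component along \<open>e\<^sub>0\<close>; this component of the \<open>n\<close>-th Taylor coefficient is \<open>a\<^sub>w\<close>.

  Hence \<open>h(X) = (M \<otimes> I) X\<close> for small \<open>X\<close>, and for all \<open>X\<close> of norm less than \<open>1\<close> by the identity
  theorem on the line through \<open>X\<close>. Evaluation at size \<open>1\<close> determines \<open>M\<close>, and an isometry from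
  \<open>\<complex>\<^sup>g\<close> to \<open>\<complex>\<^sup>m\<close> forces \<open>g \<le> m\<close>.
\<close>

no_notation vec_nth (infixl \<open>$\<close> 90)
no_notation fps_nth (infixl \<open>$\<close> 75)

section \<open>The Schwarz lemma for vector-valued functions\<close>

lemma norm_less_1_of_norm_le_1:
  assumes hol: "f holomorphic_on ball 0 1" and f0: "f 0 = 0"
    and le: "\<And>z. cmod z < 1 \<Longrightarrow> cmod (f z) \<le> 1" and z: "cmod z < 1"
  shows "cmod (f z) < 1"
proof (rule ccontr)
  assume "\<not> ?thesis"
  then have 1: "cmod (f z) = 1" using le[OF z] by simp
  have "f constant_on ball 0 1"
    by (rule maximum_modulus_principle[OF hol, of "ball 0 1" z]) (use z le 1 in auto)
  then obtain c where "\<And>u. u \<in> ball 0 1 \<Longrightarrow> f u = c" unfolding constant_on_def by blast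
  from this[of 0] this[of z] have "f z = f 0" using z by simp
  then show False using 1 f0 by simp
qed

lemma cauchy_schwarz_sum:
  "cmod (\<Sum>i\<in>I. cnj (v i) * w i) \<le> L2_set (\<lambda>i. cmod (v i)) I * L2_set (\<lambda>i. cmod (w i)) I"
proof -
  have "cmod (\<Sum>i\<in>I. cnj (v i) * w i) \<le> (\<Sum>i\<in>I. cmod (cnj (v i) * w i))" by (rule norm_sum)
  also have "\<dots> = (\<Sum>i\<in>I. \<bar>cmod (v i)\<bar> * \<bar>cmod (w i)\<bar>)" by (simp add: norm_mult)
  also have "\<dots> \<le> L2_set (\<lambda>i. cmod (v i)) I * L2_set (\<lambda>i. cmod (w i)) I"
    by (rule L2_set_mult_ineq)
  finally show ?thesis .
qed

text \<open>
  The equality case of the Schwarz lemma for a function \<open>F\<close> from the disc to the unit ball of a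
  finite-dimensional Hilbert space. The scalar Schwarz lemma is applied to functions
  \<open>\<langle>v, F(u)\<rangle>\<close> with unit vectors \<open>v\<close>: the direction \<open>v = F z / \<parallel>F z\<parallel>\<close> yields \<open>\<parallel>F z\<parallel> \<le> \<bar>z\<bar>\<close>, and
  \<open>v = F'(0)\<close> yields \<open>\<langle>F'(0), F z\<rangle> = z\<close>. Together they give \<open>\<parallel>F z - z F'(0)\<parallel>\<^sup>2 \<le> 0\<close>.
\<close>

lemma schwarz_lemma_vector:
  fixes F :: "'i \<Rightarrow> complex \<Rightarrow> complex"
  assumes fin: "finite I"
    and hol: "\<And>i. i \<in> I \<Longrightarrow> F i holomorphic_on ball 0 1"
    and F0: "\<And>i. i \<in> I \<Longrightarrow> F i 0 = 0"
    and le: "\<And>z. cmod z < 1 \<Longrightarrow> L2_set (\<lambda>i. cmod (F i z)) I \<le> 1"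
    and der: "L2_set (\<lambda>i. cmod (deriv (F i) 0)) I = 1"
    and z: "cmod z < 1" and i: "i \<in> I"
  shows "F i z = deriv (F i) 0 * z"
proof -
  define G where "G v u = (\<Sum>i\<in>I. cnj (v i) * F i u)" for v :: "'i \<Rightarrow> complex" and u
  have holG: "G v holomorphic_on ball 0 1" for v
    unfolding G_def by (intro holomorphic_intros hol)
  have G0: "G v 0 = 0" for v
    unfolding G_def by (simp add: F0)
  have G_less: "cmod (G v u) < 1" if v: "L2_set (\<lambda>i. cmod (v i)) I = 1" and u: "cmod u < 1" for v u
  proof (rule norm_less_1_of_norm_le_1[OF holG G0 _ u])
    fix y :: complex assume "cmod y < 1"
    from le[OF this] show "cmod (G v y) \<le> 1"
      using cauchy_schwarz_sum[of v "\<lambda>i. F i y" I] unfolding G_def v by simp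
  qed
  define n where "n = L2_set (\<lambda>i. cmod (F i z)) I"
  have n0: "n \<ge> 0" unfolding n_def by (rule L2_set_nonneg)
  have n2: "(\<Sum>i\<in>I. (cmod (F i z))\<^sup>2) = n\<^sup>2"
    unfolding n_def L2_set_def by (simp add: sum_nonneg)
  \<comment> \<open>the scalar Schwarz lemma in the direction of \<open>F z\<close>\<close>
  have n_le: "n \<le> cmod z"
  proof (cases "n = 0")
    case False
    then have npos: "n > 0" using n0 by simp
    define v where "v i = F i z / of_real n" for i
    have "L2_set (\<lambda>i. cmod (v i)) I = L2_set (\<lambda>i. inverse n * cmod (F i z)) I"
      unfolding v_def using npos by (intro L2_set_cong) (auto simp: norm_divide field_simps)
    also have "\<dots> = inverse n * n"
      unfolding n_def by (rule L2_set_right_distrib[symmetric]) (use npos n_def in simp)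
    finally have v1: "L2_set (\<lambda>i. cmod (v i)) I = 1" using npos by simp
    have "G v z = (\<Sum>i\<in>I. (of_real ((cmod (F i z))\<^sup>2)) / of_real n)"
      unfolding G_def v_def by (intro sum.cong refl) (simp add: complex_norm_square mult.commute del: of_real_power)
    also have "\<dots> = of_real (n\<^sup>2) / of_real n"
      by (simp add: n2[symmetric] sum_divide_distrib)
    also have "\<dots> = of_real n" using npos by (simp add: power2_eq_square)
    finally have "G v z = of_real n" .
    moreover have "cmod (G v z) \<le> cmod z"
      by (rule Schwarz_Lemma(1)[OF holG G0 G_less[OF v1] z])
    ultimately show ?thesis using n0 by simp
  qed simp
  define c where "c i = deriv (F i) 0" for i
  have c1: "L2_set (\<lambda>i. cmod (c i)) I = 1" unfolding c_def by (rule der)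
  then have c2: "(\<Sum>i\<in>I. (cmod (c i))\<^sup>2) = 1"
    unfolding L2_set_def by simp
  have dG: "deriv (G c) 0 = 1"
  proof -
    have "(F i has_field_derivative c i) (at 0)" if "i \<in> I" for i
      unfolding c_def by (rule holomorphic_derivI[OF hol[OF that]]) auto
    then have "(G c has_field_derivative (\<Sum>i\<in>I. cnj (c i) * c i)) (at 0)"
      unfolding G_def by (intro DERIV_sum DERIV_cmult)
    moreover have "(\<Sum>i\<in>I. cnj (c i) * c i) = of_real (\<Sum>i\<in>I. (cmod (c i))\<^sup>2)"
      unfolding of_real_sum by (intro sum.cong refl) (simp add: complex_norm_square mult.commute del: of_real_power)
    ultimately show ?thesis unfolding c2 by (simp add: DERIV_imp_deriv)
  qed
  obtain \<alpha> where \<alpha>: "\<And>u. cmod u < 1 \<Longrightarrow> G c u = \<alpha> * u"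
    using Schwarz_Lemma(3)[OF holG G0 G_less[OF c1] z] dG by fastforce
  have "\<alpha> = 1"
  proof -
    have "(G c has_field_derivative \<alpha>) (at 0)"
    proof (rule has_field_derivative_transform_within_open)
      show "((\<lambda>u. \<alpha> * u) has_field_derivative \<alpha>) (at 0)" by (auto intro!: derivative_eq_intros)
      show "\<alpha> * u = G c u" if "u \<in> ball 0 1" for u using \<alpha>[of u] that by simp
    qed auto
    then show ?thesis using dG DERIV_imp_deriv by force
  qed
  then have Gz: "G c z = z" using \<alpha>[OF z] by simp
  \<comment> \<open>\<open>\<parallel>F z - z c\<parallel>\<^sup>2 = \<parallel>F z\<parallel>\<^sup>2 - 2 Re (cnj z \<langle>c, F z\<rangle>) + \<bar>z\<bar>\<^sup>2 = \<parallel>F z\<parallel>\<^sup>2 - \<bar>z\<bar>\<^sup>2\<close>\<close>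
  have "of_real (\<Sum>i\<in>I. (cmod (F i z - c i * z))\<^sup>2)
      = (\<Sum>i\<in>I. of_real ((cmod (F i z))\<^sup>2) - cnj z * (cnj (c i) * F i z)
             - z * cnj (cnj (c i) * F i z) + of_real ((cmod z)\<^sup>2) * of_real ((cmod (c i))\<^sup>2))"
    unfolding of_real_sum complex_norm_square by (intro sum.cong refl) (simp add: algebra_simps)
  also have "\<dots> = of_real (n\<^sup>2) - cnj z * G c z - z * cnj (G c z) + of_real ((cmod z)\<^sup>2) * of_real 1"
    unfolding sum.distrib sum_subtractf G_def sum_distrib_left[symmetric] of_real_sum[symmetric]
      cnj_sum[symmetric] n2 c2 ..
  also have "\<dots> = of_real (n\<^sup>2 - (cmod z)\<^sup>2)"
    unfolding Gz by (simp add: complex_norm_square mult.commute del: of_real_power)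
  finally have "(\<Sum>i\<in>I. (cmod (F i z - c i * z))\<^sup>2) = n\<^sup>2 - (cmod z)\<^sup>2"
    by (simp only: of_real_eq_iff)
  also have "\<dots> \<le> 0" using n_le n0 by (simp add: power_mono)
  finally have "(\<Sum>i\<in>I. (cmod (F i z - c i * z))\<^sup>2) = 0"
    by (intro antisym sum_nonneg) auto
  then have "(cmod (F i z - c i * z))\<^sup>2 = 0"
    using fin i by (simp add: sum_nonneg_eq_0_iff)
  then show ?thesis by (simp add: c_def)
qed

section \<open>The operator norm\<close>

lemma l2_norm_vec_sq: "(l2_norm_vec v)\<^sup>2 = (\<Sum>i<dim_vec v. (cmod (v $ i))\<^sup>2)"
  unfolding l2_norm_vec_def L2_set_def by (simp add: sum_nonneg)

lemma l2_norm_vec_nonneg: "l2_norm_vec v \<ge> 0"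
  unfolding l2_norm_vec_def by (rule L2_set_nonneg)

lemma l2_norm_vec_smult: "l2_norm_vec (c \<cdot>\<^sub>v v) = cmod c * l2_norm_vec v"
  unfolding l2_norm_vec_def L2_set_right_distrib[OF norm_ge_zero]
  by (intro L2_set_cong) (auto simp: norm_mult)

lemma l2_norm_vec_eq_0_iff: "l2_norm_vec v = 0 \<longleftrightarrow> v = 0\<^sub>v (dim_vec v)"
proof -
  have "l2_norm_vec v = 0 \<longleftrightarrow> (l2_norm_vec v)\<^sup>2 = 0" by simp
  also have "\<dots> \<longleftrightarrow> (\<forall>i<dim_vec v. v $ i = 0)"
    unfolding l2_norm_vec_sq by (simp add: sum_nonneg_eq_0_iff Ball_def)
  also have "\<dots> \<longleftrightarrow> v = 0\<^sub>v (dim_vec v)" by (auto simp: vec_eq_iff)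
  finally show ?thesis .
qed

lemma l2_norm_unit_vec: "k < n \<Longrightarrow> l2_norm_vec (unit_vec n k) = 1"
proof -
  assume k: "k < n"
  have "(l2_norm_vec (unit_vec n k))\<^sup>2 = (\<Sum>i<n. if i = k then 1 else 0)"
    unfolding l2_norm_vec_sq using k by (intro sum.cong) auto
  also have "\<dots> = 1" using k by simp
  finally show ?thesis using l2_norm_vec_nonneg[of "unit_vec n k"] by (simp add: power2_eq_1_iff)
qed

lemma norm_component_le_l2: "i < dim_vec v \<Longrightarrow> cmod (v $ i) \<le> l2_norm_vec v"
  unfolding l2_norm_vec_def by (rule member_le_L2_set) auto

lemma mult_mat_vec_entry:
  assumes "i < dim_row A" "v \<in> carrier_vec (dim_col A)"
  shows "(A *\<^sub>v v) $ i = (\<Sum>j<dim_col A. A $$ (i, j) * v $ j)"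
proof -
  have "(A *\<^sub>v v) $ i = (\<Sum>j<dim_col A. row A i $ j * v $ j)"
    using assms by (simp add: scalar_prod_def atLeast0LessThan)
  also have "\<dots> = (\<Sum>j<dim_col A. A $$ (i, j) * v $ j)"
    using assms by (intro sum.cong) auto
  finally show ?thesis .
qed

lemma op_norm_bdd_above:
  "bdd_above ((\<lambda>v. l2_norm_vec (A *\<^sub>v v)) ` {v \<in> carrier_vec (dim_col A). l2_norm_vec v \<le> 1})"
proof (rule bdd_aboveI2)
  fix v assume v: "v \<in> {v \<in> carrier_vec (dim_col A). l2_norm_vec v \<le> 1}"
  have "l2_norm_vec (A *\<^sub>v v) \<le> (\<Sum>i<dim_row A. \<bar>cmod ((A *\<^sub>v v) $ i)\<bar>)"
    unfolding l2_norm_vec_def dim_mult_mat_vec by (rule L2_set_le_sum_abs)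
  also have "\<dots> \<le> (\<Sum>i<dim_row A. \<Sum>j<dim_col A. cmod (A $$ (i, j)))"
  proof (rule sum_mono)
    fix i assume i: "i \<in> {..<dim_row A}"
    have "\<bar>cmod ((A *\<^sub>v v) $ i)\<bar> = cmod (\<Sum>j<dim_col A. A $$ (i, j) * v $ j)"
      using mult_mat_vec_entry[of i A v] i v by simp
    also have "\<dots> \<le> (\<Sum>j<dim_col A. cmod (A $$ (i, j) * v $ j))" by (rule norm_sum)
    also have "\<dots> \<le> (\<Sum>j<dim_col A. cmod (A $$ (i, j)))"
    proof (rule sum_mono)
      fix j assume "j \<in> {..<dim_col A}"
      then have "cmod (v $ j) \<le> 1" using norm_component_le_l2[of j v] v by auto
      then show "cmod (A $$ (i, j) * v $ j) \<le> cmod (A $$ (i, j))"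
        by (simp add: norm_mult mult_left_le)
    qed
    finally show "\<bar>cmod ((A *\<^sub>v v) $ i)\<bar> \<le> (\<Sum>j<dim_col A. cmod (A $$ (i, j)))" .
  qed
  finally show "l2_norm_vec (A *\<^sub>v v) \<le> (\<Sum>i<dim_row A. \<Sum>j<dim_col A. cmod (A $$ (i, j)))" .
qed

lemma l2_norm_mult_le_op_norm:
  assumes "v \<in> carrier_vec (dim_col A)" "l2_norm_vec v \<le> 1"
  shows "l2_norm_vec (A *\<^sub>v v) \<le> op_norm A"
  unfolding op_norm_def by (rule cSUP_upper[OF _ op_norm_bdd_above]) (use assms in auto)

lemma op_norm_leI:
  assumes "\<And>v. v \<in> carrier_vec (dim_col A) \<Longrightarrow> l2_norm_vec v \<le> 1 \<Longrightarrow> l2_norm_vec (A *\<^sub>v v) \<le> c"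
  shows "op_norm A \<le> c"
proof -
  have "l2_norm_vec (0\<^sub>v (dim_col A)) \<le> 1" using l2_norm_vec_eq_0_iff[of "0\<^sub>v (dim_col A)"] by simp
  then have "0\<^sub>v (dim_col A) \<in> {v \<in> carrier_vec (dim_col A). l2_norm_vec v \<le> 1}" by simp
  then have "{v \<in> carrier_vec (dim_col A). l2_norm_vec v \<le> 1} \<noteq> {}" by blast
  then show ?thesis unfolding op_norm_def by (rule cSUP_least) (use assms in auto)
qed

lemma op_norm_nonneg: "op_norm A \<ge> 0"
proof -
  have "l2_norm_vec (0\<^sub>v (dim_col A)) \<le> 1" using l2_norm_vec_eq_0_iff[of "0\<^sub>v (dim_col A)"] by simp
  then have "l2_norm_vec (A *\<^sub>v 0\<^sub>v (dim_col A)) \<le> op_norm A"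
    by (rule l2_norm_mult_le_op_norm[rotated]) simp
  then show ?thesis using l2_norm_vec_nonneg[of "A *\<^sub>v 0\<^sub>v (dim_col A)"] by (rule order_trans[rotated])
qed

lemma op_norm_smult_le: "op_norm (c \<cdot>\<^sub>m A) \<le> cmod c * op_norm A"
proof (rule op_norm_leI)
  fix v assume v: "v \<in> carrier_vec (dim_col (c \<cdot>\<^sub>m A))" "l2_norm_vec v \<le> 1"
  have "(c \<cdot>\<^sub>m A) *\<^sub>v v = c \<cdot>\<^sub>v (A *\<^sub>v v)"
    using v by (auto simp: vec_eq_iff scalar_prod_def sum_distrib_left mult.assoc)
  then show "l2_norm_vec ((c \<cdot>\<^sub>m A) *\<^sub>v v) \<le> cmod c * op_norm A"
    using l2_norm_mult_le_op_norm[of v A] v by (simp add: l2_norm_vec_smult mult_left_mono)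
qed

lemma smult_in_int_nc_ball:
  assumes "X \<in> block_mats g 1 N" "op_norm X \<le> 1" "cmod u < 1"
  shows "u \<cdot>\<^sub>m X \<in> int_nc_ball g 1 N"
proof -
  have "op_norm (u \<cdot>\<^sub>m X) \<le> cmod u * op_norm X" by (rule op_norm_smult_le)
  also have "\<dots> \<le> cmod u * 1" using assms by (intro mult_left_mono) auto
  finally show ?thesis using assms by (auto simp: int_nc_ball_def block_mats_def)
qed

lemma column_norm_le_op_norm:
  assumes "k < dim_col A"
  shows "L2_set (\<lambda>i. cmod (A $$ (i, k))) {..<dim_row A} \<le> op_norm A"
proof -
  have "L2_set (\<lambda>i. cmod (A $$ (i, k))) {..<dim_row A} = l2_norm_vec (A *\<^sub>v unit_vec (dim_col A) k)"
    unfolding l2_norm_vec_def using assms by (intro L2_set_cong) auto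
  also have "\<dots> \<le> op_norm A"
    using assms by (intro l2_norm_mult_le_op_norm) (auto simp: l2_norm_unit_vec)
  finally show ?thesis .
qed

lemma op_norm_single_column:
  assumes k: "k < dim_col A"
    and 0: "\<And>i j. i < dim_row A \<Longrightarrow> j < dim_col A \<Longrightarrow> j \<noteq> k \<Longrightarrow> A $$ (i, j) = 0"
  shows "op_norm A = L2_set (\<lambda>i. cmod (A $$ (i, k))) {..<dim_row A}"
proof (rule antisym[OF op_norm_leI column_norm_le_op_norm[OF k]])
  fix v assume v: "v \<in> carrier_vec (dim_col A)" "l2_norm_vec v \<le> 1"
  have *: "(A *\<^sub>v v) $ i = v $ k * A $$ (i, k)" if "i < dim_row A" for i
  proof -
    have "(A *\<^sub>v v) $ i = (\<Sum>j<dim_col A. A $$ (i, j) * v $ j)"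
      using mult_mat_vec_entry that v by blast
    also have "\<dots> = (\<Sum>j\<in>{k}. A $$ (i, j) * v $ j)"
      using that k 0 by (intro sum.mono_neutral_right) auto
    finally show ?thesis by simp
  qed
  have "l2_norm_vec (A *\<^sub>v v) = cmod (v $ k) * L2_set (\<lambda>i. cmod (A $$ (i, k))) {..<dim_row A}"
    unfolding l2_norm_vec_def L2_set_right_distrib[OF norm_ge_zero]
    by (intro L2_set_cong) (auto simp: * norm_mult simp del: index_mult_mat_vec)
  also have "\<dots> \<le> 1 * L2_set (\<lambda>i. cmod (A $$ (i, k))) {..<dim_row A}"
    using norm_component_le_l2[of k v] v k by (intro mult_right_mono L2_set_nonneg) auto
  finally show "l2_norm_vec (A *\<^sub>v v) \<le> L2_set (\<lambda>i. cmod (A $$ (i, k))) {..<dim_row A}" by simp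
qed

text \<open>
  Were \<open>m < g\<close>, then padding \<open>M\<close> with zero rows would give a singular square matrix, hence a
  nonzero vector in the kernel of \<open>M\<close>.
\<close>

lemma isometry_mat_imp_le:
  assumes M: "M \<in> carrier_mat m g" and iso: "isometry_mat M"
  shows "g \<le> m"
proof (rule ccontr)
  assume "\<not> g \<le> m"
  then have mg: "m < g" by simp
  define A where "A = mat g g (\<lambda>(i, j). if i < m then M $$ (i, j) else 0)"
  have A: "A \<in> carrier_mat g g" by (simp add: A_def)
  have "A\<^sup>T *\<^sub>v unit_vec g m = 0\<^sub>v g"
    using mg by (auto simp: A_def vec_eq_iff)
  moreover have "unit_vec g m \<noteq> (0\<^sub>v g :: complex vec)"
    using mg by (metis index_unit_vec(2) index_zero_vec(1) zero_neq_one)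
  ultimately have "det (A\<^sup>T) = 0"
    using det_0_iff_vec_prod_zero[of "A\<^sup>T" g] A by (metis transpose_carrier_mat unit_vec_carrier)
  then have "det A = 0" using det_transpose[OF A] by simp
  then obtain v where v: "v \<in> carrier_vec g" "v \<noteq> 0\<^sub>v g" "A *\<^sub>v v = 0\<^sub>v g"
    using det_0_iff_vec_prod_zero[OF A] by blast
  have "(M *\<^sub>v v) $ i = 0" if i: "i < m" for i
  proof -
    have "(M *\<^sub>v v) $ i = (\<Sum>j<g. M $$ (i, j) * v $ j)"
      using mult_mat_vec_entry[of i M v] M v i by simp
    also have "\<dots> = (\<Sum>j<g. A $$ (i, j) * v $ j)"
      using i mg by (simp add: A_def)
    also have "\<dots> = (A *\<^sub>v v) $ i"
      using mult_mat_vec_entry[of i A v] A v i mg by simp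
    finally show ?thesis using v i mg by simp
  qed
  then have "M *\<^sub>v v = 0\<^sub>v m" using M by (auto simp: vec_eq_iff)
  then have "l2_norm_vec (M *\<^sub>v v) = 0" using l2_norm_vec_eq_0_iff[of "0\<^sub>v m"] by simp
  then have "l2_norm_vec v = 0" using iso v M unfolding isometry_mat_def by auto
  then show False using v l2_norm_vec_eq_0_iff[of v] by auto
qed

section \<open>Evaluation of words and Kronecker products\<close>

lemma sum_lessThan_mult:
  fixes f :: "nat \<Rightarrow> 'a::comm_monoid_add"
  shows "(\<Sum>i<m * N. f i) = (\<Sum>p<m. \<Sum>q<N. f (p * N + q))"
proof -
  have "(\<Sum>p<m. \<Sum>q<N. f (p * N + q)) = (\<Sum>p<m. sum f {p * N..<p * N + N})"
  proof (rule sum.cong[OF refl])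
    fix p
    have "sum f {p * N..<p * N + N} = sum f {0 + p * N..<N + p * N}" by (simp add: add.commute)
    also have "\<dots> = (\<Sum>q<N. f (p * N + q))"
      unfolding sum.shift_bounds_nat_ivl by (simp add: atLeast0LessThan add.commute)
    finally show "(\<Sum>q<N. f (p * N + q)) = sum f {p * N..<p * N + N}" ..
  qed
  then show ?thesis by (simp add: sum.nat_group)
qed

lemma L2_set_one_row_per_block:
  fixes f :: "nat \<Rightarrow> real"
  assumes k: "k < N" and 0: "\<And>p q. p < n \<Longrightarrow> q < N \<Longrightarrow> q \<noteq> k \<Longrightarrow> f (p * N + q) = 0"
  shows "L2_set f {..<n * N} = L2_set (\<lambda>p. f (p * N + k)) {..<n}"
proof -
  have "(\<Sum>q<N. (f (p * N + q))\<^sup>2) = (f (p * N + k))\<^sup>2" if "p < n" for p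
  proof -
    have "(\<Sum>q<N. (f (p * N + q))\<^sup>2) = (\<Sum>q\<in>{k}. (f (p * N + q))\<^sup>2)"
      using k 0 that by (intro sum.mono_neutral_right) auto
    then show ?thesis by simp
  qed
  then show ?thesis unfolding L2_set_def sum_lessThan_mult by simp
qed

lemma block_row_less:
  assumes "j < g" "q < N" shows "j * N + q < g * (N::nat)"
proof -
  have "j * N + q < Suc j * N" using assms by simp
  also have "\<dots> \<le> g * N" using assms by (intro mult_le_mono1) simp
  finally show ?thesis .
qed

lemma word_eval_carrier [simp]: "word_eval N X w \<in> carrier_mat N N"
  by (induction w) (auto simp: block_def)

lemma word_eval_dim [simp]: "dim_row (word_eval N X w) = N" "dim_col (word_eval N X w) = N"
  by (rule carrier_matD[OF word_eval_carrier])+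

lemma word_eval_Cons_entry:
  assumes "q < N" "k < N"
  shows "word_eval N X (j # w) $$ (q, k) = (\<Sum>s<N. X $$ (j * N + q, s) * word_eval N X w $$ (s, k))"
  using assms by (simp add: block_def scalar_prod_def atLeast0LessThan)

lemma word_eval_smult:
  assumes X: "X \<in> carrier_mat (g * N) N" and w: "set w \<subseteq> {..<g}" and "q < N" "k < N"
  shows "word_eval N (c \<cdot>\<^sub>m X) w $$ (q, k) = c ^ length w * word_eval N X w $$ (q, k)"
  using w \<open>q < N\<close>
proof (induction w arbitrary: q)
  case (Cons j w)
  have "word_eval N (c \<cdot>\<^sub>m X) (j # w) $$ (q, k)
      = (\<Sum>s<N. (c \<cdot>\<^sub>m X) $$ (j * N + q, s) * word_eval N (c \<cdot>\<^sub>m X) w $$ (s, k))"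
    using Cons.prems \<open>k < N\<close> by (intro word_eval_Cons_entry)
  also have "\<dots> = (\<Sum>s<N. c ^ length (j # w) * (X $$ (j * N + q, s) * word_eval N X w $$ (s, k)))"
  proof (rule sum.cong[OF refl])
    fix s assume "s \<in> {..<N}"
    then have "(c \<cdot>\<^sub>m X) $$ (j * N + q, s) = c * X $$ (j * N + q, s)"
      using X Cons.prems block_row_less[of j g q N] by auto
    then show "(c \<cdot>\<^sub>m X) $$ (j * N + q, s) * word_eval N (c \<cdot>\<^sub>m X) w $$ (s, k)
        = c ^ length (j # w) * (X $$ (j * N + q, s) * word_eval N X w $$ (s, k))"
      using Cons \<open>s \<in> {..<N}\<close> by simp
  qed
  also have "\<dots> = c ^ length (j # w) * word_eval N X (j # w) $$ (q, k)"
    unfolding sum_distrib_left[symmetric] using Cons.prems \<open>k < N\<close> word_eval_Cons_entry by simp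
  finally show ?case .
qed (use \<open>k < N\<close> in auto)

lemma kron_square_entry:
  assumes "A \<in> carrier_mat m 1" "B \<in> carrier_mat N N" "i < m * N" "j < N"
  shows "kron A B $$ (i, j) = A $$ (i div N, 0) * B $$ (i mod N, j)"
  using assms by (auto simp: kron_def)

lemma kron_id_carrier: "A \<in> carrier_mat m g \<Longrightarrow> kron A (1\<^sub>m N) \<in> carrier_mat (m * N) (g * N)"
  by (auto simp: kron_def)

lemma kron_id_mult_entry:
  assumes M: "M \<in> carrier_mat m g" and X: "X \<in> carrier_mat (g * N) N" and i: "i < m * N" and j: "j < N"
  shows "(kron M (1\<^sub>m N) * X) $$ (i, j) = (\<Sum>l<g. M $$ (i div N, l) * X $$ (l * N + i mod N, j))"
proof -
  have N: "N > 0" using j by simp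
  have "(kron M (1\<^sub>m N) * X) $$ (i, j) = (\<Sum>k<g * N. kron M (1\<^sub>m N) $$ (i, k) * X $$ (k, j))"
    using M X i j by (auto simp: kron_def scalar_prod_def atLeast0LessThan intro!: sum.cong)
  also have "\<dots> = (\<Sum>l<g. \<Sum>q<N. kron M (1\<^sub>m N) $$ (i, l * N + q) * X $$ (l * N + q, j))"
    by (rule sum_lessThan_mult)
  also have "\<dots> = (\<Sum>l<g. \<Sum>q<N. if q = i mod N then M $$ (i div N, l) * X $$ (l * N + q, j) else 0)"
    using M i N block_row_less[of _ g _ N] by (intro sum.cong refl) (auto simp: kron_def)
  also have "\<dots> = (\<Sum>l<g. M $$ (i div N, l) * X $$ (l * N + i mod N, j))"
    using N by (intro sum.cong refl) simp
  finally show ?thesis .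
qed

text \<open>
  The columns of the matrix are read off at the points \<open>e\<^sub>l / 2\<close> of size \<open>1\<close>.
\<close>

lemma kron_linear_unique:
  assumes A: "A \<in> carrier_mat m g" and B: "B \<in> carrier_mat m g"
    and eq: "\<And>X. X \<in> int_nc_ball g 1 1 \<Longrightarrow> kron A (1\<^sub>m 1) * X = kron B (1\<^sub>m 1) * X"
  shows "A = B"
proof (rule eq_matI)
  fix p l assume "p < dim_row B" "l < dim_col B"
  then have p: "p < m" and l: "l < g" using B by auto
  define X :: "complex mat" where "X = mat g 1 (\<lambda>(r, _). if r = l then 1 / 2 else 0)"
  have X: "X \<in> carrier_mat (g * 1) 1" by (simp add: X_def)
  have "op_norm X = L2_set (\<lambda>r. cmod (X $$ (r, 0))) {..<g}"
    using op_norm_single_column[of 0 X] by (simp add: X_def)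
  also have "\<dots> = L2_set (\<lambda>r. if r = l then 1 / 2 else 0) {..<g}"
    by (intro L2_set_cong) (auto simp: X_def)
  also have "\<dots> = 1 / 2"
    using l by (simp add: L2_set_def if_distrib[of "\<lambda>x. x\<^sup>2"] real_sqrt_divide power_divide cong: if_cong)
  finally have "X \<in> int_nc_ball g 1 1" using X by (simp add: int_nc_ball_def block_mats_def)
  from eq[OF this] have "(kron A (1\<^sub>m 1) * X) $$ (p, 0) = (kron B (1\<^sub>m 1) * X) $$ (p, 0)" by simp
  moreover have C: "(kron C (1\<^sub>m 1) * X) $$ (p, 0) = C $$ (p, l) / 2" if C: "C \<in> carrier_mat m g" for C
  proof -
    have "(kron C (1\<^sub>m 1) * X) $$ (p, 0) = (\<Sum>r<g. C $$ (p, r) * X $$ (r, 0))"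
      using kron_id_mult_entry[OF C X, of p 0] p by simp
    also have "\<dots> = (\<Sum>r<g. if r = l then C $$ (p, r) / 2 else 0)"
      by (intro sum.cong) (auto simp: X_def)
    also have "\<dots> = C $$ (p, l) / 2" using l by simp
    finally show ?thesis .
  qed
  ultimately show "A $$ (p, l) = B $$ (p, l)" unfolding C[OF A] C[OF B] by simp
qed (use A B in auto)

lemma linear_on_ball_kron:
  assumes M: "M \<in> carrier_mat m g"
    and h: "\<And>N X. N > 0 \<Longrightarrow> X \<in> int_nc_ball g 1 N \<Longrightarrow> h X = kron M (1\<^sub>m N) * X"
  shows "linear_on_ball g h"
  unfolding linear_on_ball_def
proof (intro allI ballI impI)
  fix N X Y and c d :: complex
  assume N: "N > 0" and X: "X \<in> int_nc_ball g 1 N" and Y: "Y \<in> int_nc_ball g 1 N"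
    and XY: "c \<cdot>\<^sub>m X + d \<cdot>\<^sub>m Y \<in> int_nc_ball g 1 N"
  have K: "kron M (1\<^sub>m N) \<in> carrier_mat (m * N) (g * N)" by (rule kron_id_carrier[OF M])
  have Xc: "X \<in> carrier_mat (g * N) N" and Yc: "Y \<in> carrier_mat (g * N) N"
    using X Y by (simp_all add: int_nc_ball_def block_mats_def)
  have "kron M (1\<^sub>m N) * (c \<cdot>\<^sub>m X + d \<cdot>\<^sub>m Y) = kron M (1\<^sub>m N) * (c \<cdot>\<^sub>m X) + kron M (1\<^sub>m N) * (d \<cdot>\<^sub>m Y)"
    using Xc Yc by (intro mult_add_distrib_mat[OF K]) auto
  then show "h (c \<cdot>\<^sub>m X + d \<cdot>\<^sub>m Y) = c \<cdot>\<^sub>m h X + d \<cdot>\<^sub>m h Y"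
    unfolding h[OF N X] h[OF N Y] h[OF N XY]
    by (simp add: mult_smult_distrib[OF K Xc] mult_smult_distrib[OF K Yc])
qed

section \<open>NC analytic functions on complex lines\<close>

text \<open>
  The point of the encoded \<open>\<complex>\<^sup>1\<close> (sequences that vanish from index \<open>1\<close> on) with coordinate \<open>u\<close>.
\<close>

definition disc_point :: "complex \<Rightarrow> nat \<Rightarrow> complex" where
  "disc_point u = (\<lambda>i. if i = 0 then u else 0)"

text \<open>
  The open unit disc as a domain in the encoded \<open>\<complex>\<^sup>1\<close>.
\<close>

definition unit_disc :: "(nat \<Rightarrow> complex) set" where
  "unit_disc = disc_point ` ball 0 1"

lemma unit_disc_eq: "unit_disc = complex_space 1 \<inter> {z. z 0 \<in> ball 0 1}"
proof (intro equalityI subsetI)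
  fix z assume z: "z \<in> complex_space 1 \<inter> {z. z 0 \<in> ball 0 1}"
  then have "z = disc_point (z 0)" by (auto simp: disc_point_def complex_space_def fun_eq_iff)
  then show "z \<in> unit_disc" using z unfolding unit_disc_def by blast
qed (auto simp: unit_disc_def disc_point_def complex_space_def)

lemma complex_domain_unit_disc: "complex_domain 1 unit_disc"
proof -
  have "open {z :: nat \<Rightarrow> complex. z 0 \<in> ball 0 1}"
    using open_vimage[of "ball 0 1" "\<lambda>z :: nat \<Rightarrow> complex. z 0"] continuous_on_product_coordinates
    by (simp add: vimage_def)
  then have "openin (top_of_set (complex_space 1)) unit_disc"
    unfolding unit_disc_eq by (rule openin_open_Int)
  moreover have "connected unit_disc"
    unfolding unit_disc_def
  proof (rule connected_continuous_image)
    have "continuous_on (ball 0 1) (\<lambda>u. disc_point u i)" for i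
      by (cases "i = 0") (simp_all add: disc_point_def)
    then show "continuous_on (ball 0 1) disc_point"
      by (rule continuous_on_coordinatewise_then_product)
  qed simp
  moreover have "unit_disc \<noteq> {}" unfolding unit_disc_def by simp
  ultimately show ?thesis unfolding complex_domain_def by blast
qed

lemma mat_analytic_on_ray: "mat_analytic_on (g * N) N 1 unit_disc (\<lambda>z. z 0 \<cdot>\<^sub>m X)"
  if X: "X \<in> carrier_mat (g * N) N"
  unfolding mat_analytic_on_def multi_analytic_on_def
proof (intro allI impI ballI)
  fix i j p assume ij: "i < g * N" "j < N" and p: "p \<in> unit_disc"
  define x where "x = X $$ (i, j)"
  \<comment> \<open>the expansion \<open>z X = p X + (z - p) X\<close> at \<open>p\<close> has terms of degree \<open>0\<close> and \<open>1\<close> only\<close>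
  define c where "c \<mu> = (if \<mu> = (\<lambda>_. 0) then p 0 * x else if \<mu> = (\<lambda>i. if i = 0 then 1 else 0) then x else 0)"
    for \<mu> :: "nat \<Rightarrow> nat"
  let ?u = "\<lambda>i::nat. if i = 0 then 1 else 0 :: nat"
  have ne: "?u \<noteq> (\<lambda>_. 0)" by (metis zero_neq_one)
  have "((\<lambda>\<mu>. c \<mu> * (\<Prod>i<1. (z i - p i) ^ \<mu> i)) has_sum (z 0 \<cdot>\<^sub>m X) $$ (i, j))
      {\<mu>. \<forall>i\<ge>1. \<mu> i = 0}" for z
  proof (rule has_sum_finite_neutralI)
    show "finite {\<lambda>_. 0, ?u}" by simp
    have "(\<Sum>\<mu>\<in>{\<lambda>_. 0, ?u}. c \<mu> * (\<Prod>i<1. (z i - p i) ^ \<mu> i)) = p 0 * x + x * (z 0 - p 0)"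
      using ne ne[symmetric] by (simp add: c_def)
    then show "(z 0 \<cdot>\<^sub>m X) $$ (i, j) = (\<Sum>\<mu>\<in>{\<lambda>_. 0, ?u}. c \<mu> * (\<Prod>i<1. (z i - p i) ^ \<mu> i))"
      using X ij by (simp add: x_def algebra_simps)
  qed (auto simp: c_def)
  then show "\<exists>c r. r > 0 \<and> (\<forall>z\<in>unit_disc. (\<forall>i<1. cmod (z i - p i) < r) \<longrightarrow>
      ((\<lambda>\<mu>. c \<mu> * (\<Prod>i<1. (z i - p i) ^ \<mu> i)) has_sum (z 0 \<cdot>\<^sub>m X) $$ (i, j)) {\<mu>. \<forall>i\<ge>1. \<mu> i = 0})"
    by (intro exI[of _ c] exI[of _ 1]) auto
qed

lemma multi_analytic_on_unit_disc_imp_holomorphic: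
  assumes "multi_analytic_on 1 unit_disc F"
  shows "(\<lambda>u. F (disc_point u)) holomorphic_on ball 0 1"
proof -
  have "(\<lambda>u. F (disc_point u)) field_differentiable at p" if p: "p \<in> ball 0 1" for p
  proof -
    have "disc_point p \<in> unit_disc" using p unfolding unit_disc_def by blast
    from bspec[OF assms[unfolded multi_analytic_on_def] this]
    obtain c r where cr: "r > 0 \<and> (\<forall>z\<in>unit_disc. (\<forall>i<1. cmod (z i - disc_point p i) < r) \<longrightarrow>
        ((\<lambda>\<mu>. c \<mu> * (\<Prod>i<1. (z i - disc_point p i) ^ \<mu> i)) has_sum F z) {\<mu>. \<forall>i\<ge>1. \<mu> i = 0})"
      by (elim exE)
    then have r: "r > 0" by (rule conjunct1)
    define s where "s = min r (1 - cmod p)"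
    have s: "s > 0" using r p by (simp add: s_def)
    let ?e = "\<lambda>n i::nat. if i = 0 then n else 0 :: nat"
    have bij: "bij_betw ?e UNIV {\<mu>. \<forall>i\<ge>1. \<mu> i = 0}"
      by (rule bij_betw_byWitness[where f' = "\<lambda>\<mu>. \<mu> 0"]) (auto simp: fun_eq_iff)
    have "(\<lambda>u. F (disc_point u)) holomorphic_on ball p s"
    proof (rule power_series_holomorphic)
      fix w assume w: "w \<in> ball p s"
      have "cmod w < 1" using w norm_triangle_ineq[of "w - p" p]
        by (simp add: s_def dist_norm norm_minus_commute)
      then have "disc_point w \<in> unit_disc" unfolding unit_disc_def by simp
      from bspec[OF conjunct2[OF cr] this] w have "((\<lambda>\<mu>. c \<mu> * (w - p) ^ \<mu> 0) has_sum F (disc_point w)) {\<mu>. \<forall>i\<ge>1. \<mu> i = 0}"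
        by (simp add: disc_point_def s_def dist_norm norm_minus_commute)
      then have "((\<lambda>n. c (?e n) * (w - p) ^ n) has_sum F (disc_point w)) UNIV"
        using has_sum_reindex_bij_betw[OF bij, of "\<lambda>\<mu>. c \<mu> * (w - p) ^ \<mu> 0"] by simp
      then show "(\<lambda>n. c (?e n) * (w - p) ^ n) sums F (disc_point w)" by (rule has_sum_imp_sums)
    qed
    then show ?thesis
      using s by (intro holomorphic_on_imp_differentiable_at[of _ "ball p s"]) auto
  qed
  then show ?thesis by (auto simp: holomorphic_on_def field_differentiable_at_within)
qed

lemma nc_analytic_ray_holomorphic:
  assumes f: "nc_analytic g m d f" and N: "N > 0"
    and X: "X \<in> block_mats g 1 N" "op_norm X \<le> 1" and ij: "i < m * N" "j < d * N"
  shows "(\<lambda>u. f (u \<cdot>\<^sub>m X) $$ (i, j)) holomorphic_on ball 0 1"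
proof -
  have X': "X \<in> carrier_mat (g * N) N" using X by (simp add: block_mats_def)
  have "(\<lambda>z. z 0 \<cdot>\<^sub>m X) ` unit_disc \<subseteq> int_nc_ball g 1 N"
    using smult_in_int_nc_ball[OF X] by (auto simp: unit_disc_def disc_point_def)
  then have "complex_domain 1 unit_disc \<and> mat_analytic_on (g * N) N 1 unit_disc (\<lambda>z. z 0 \<cdot>\<^sub>m X) \<and>
      (\<lambda>z. z 0 \<cdot>\<^sub>m X) ` unit_disc \<subseteq> int_nc_ball g 1 N"
    using complex_domain_unit_disc mat_analytic_on_ray[OF X'] by blast
  then have "mat_analytic_on (m * N) (d * N) 1 unit_disc (\<lambda>z. f (z 0 \<cdot>\<^sub>m X))"
    by (rule f[unfolded nc_analytic_def, THEN conjunct2, THEN conjunct2, rule_format, THEN conjunct1,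
          OF _ N, rotated]) simp
  then have "multi_analytic_on 1 unit_disc (\<lambda>z. f (z 0 \<cdot>\<^sub>m X) $$ (i, j))"
    using ij unfolding mat_analytic_on_def by blast
  from multi_analytic_on_unit_disc_imp_holomorphic[OF this] show ?thesis
    by (simp add: disc_point_def)
qed

text \<open>
  The \<open>(i, j)\<close> entry of the homogeneous part of degree \<open>\<alpha>\<close>, that is of \<open>\<Sum>a\<^sub>w \<otimes> w(X)\<close> over the words
  \<open>w\<close> of length \<open>\<alpha>\<close>, for column coefficients \<open>a\<^sub>w\<close> and blocks of size \<open>N\<close>.
\<close>

definition homogeneous_entry ::
    "nat \<Rightarrow> (nat list \<Rightarrow> complex mat) \<Rightarrow> nat \<Rightarrow> complex mat \<Rightarrow> nat \<Rightarrow> nat \<Rightarrow> nat \<Rightarrow> complex" where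
  "homogeneous_entry g a N X \<alpha> i j =
     (\<Sum>w\<in>words g \<alpha>. a w $$ (i div N, 0) * word_eval N X w $$ (i mod N, j))"

text \<open>
  The matrix whose \<open>l\<close>-th column is the coefficient of the word consisting of the variable \<open>x\<^sub>l\<close>.
\<close>

definition linear_coeff :: "nat \<Rightarrow> nat \<Rightarrow> (nat list \<Rightarrow> complex mat) \<Rightarrow> complex mat" where
  "linear_coeff m g a = mat m g (\<lambda>(p, l). a [l] $$ (p, 0))"

lemma linear_coeff_carrier [simp]: "linear_coeff m g a \<in> carrier_mat m g"
  by (simp add: linear_coeff_def)

lemma homogeneous_entry_1:
  assumes X: "X \<in> carrier_mat (g * N) N" and i: "i < m * N" and j: "j < N"
  shows "homogeneous_entry g a N X 1 i j = (kron (linear_coeff m g a) (1\<^sub>m N) * X) $$ (i, j)"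
proof -
  have N: "i mod N < N" "i div N < m" using i j by (auto simp: less_mult_imp_div_less)
  have words: "words g 1 = (\<lambda>l. [l]) ` {..<g}"
    by (auto simp: words_def length_Suc_conv)
  have "word_eval N X [l] $$ (i mod N, j) = X $$ (l * N + i mod N, j)" if "l < g" for l
    using N j right_mult_one_mat[of "block N X l 0" N N] by (simp add: block_def)
  then have "homogeneous_entry g a N X 1 i j = (\<Sum>l<g. a [l] $$ (i div N, 0) * X $$ (l * N + i mod N, j))"
    unfolding homogeneous_entry_def words by (simp add: sum.reindex inj_on_def del: word_eval.simps)
  also have "\<dots> = (\<Sum>l<g. linear_coeff m g a $$ (i div N, l) * X $$ (l * N + i mod N, j))"
    using N by (simp add: linear_coeff_def)
  also have "\<dots> = (kron (linear_coeff m g a) (1\<^sub>m N) * X) $$ (i, j)"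
    using kron_id_mult_entry[OF linear_coeff_carrier X i j] by simp
  finally show ?thesis .
qed

section \<open>The cyclic shift of a word\<close>

text \<open>
  The column \<open>X\<close> of \<open>g\<close> matrices of size \<open>N = n + 1\<close> attached to a word \<open>w\<close> of length \<open>n\<close> has
  exactly one entry \<open>1\<close> in each of its \<open>N\<close> columns and zeros elsewhere; \<open>shift_row w k\<close> is the row of
  that entry in column \<open>k\<close>. As a block matrix, \<open>X\<close> sends \<open>e\<^bsub>k+1\<^esub>\<close> to \<open>e\<^sub>k\<close> in block \<open>w ! k\<close>, and
  \<open>e\<^sub>0\<close> to \<open>e\<^sub>n\<close> in block \<open>0\<close>. The last clause makes \<open>X\<close> an isometry.
\<close>

definition shift_row :: "nat list \<Rightarrow> nat \<Rightarrow> nat" where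
  "shift_row w k = (if k = 0 then length w else w ! (k - 1) * Suc (length w) + (k - 1))"

text \<open>
  The column isometry \<open>X\<close> described above, as an ordinary \<open>g * N\<close> by \<open>N\<close> matrix.
\<close>

definition cyclic_shift :: "nat \<Rightarrow> nat list \<Rightarrow> complex mat" where
  "cyclic_shift g w = mat (g * Suc (length w)) (Suc (length w)) (\<lambda>(r, k). if r = shift_row w k then 1 else 0)"

lemma cyclic_shift_carrier: "cyclic_shift g w \<in> carrier_mat (g * Suc (length w)) (Suc (length w))"
  by (simp add: cyclic_shift_def)

lemma shift_row_less:
  assumes w: "set w \<subseteq> {..<g}" "g > 0" and k: "k < Suc (length w)"
  shows "shift_row w k < g * Suc (length w)"
proof (cases k)
  case 0
  then show ?thesis using block_row_less[of 0 g "length w" "Suc (length w)"] w by (simp add: shift_row_def)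
next
  case (Suc k')
  then have "k' < length w" using k by simp
  then have "w ! k' < g" using subsetD[OF w(1) nth_mem] by simp
  then show ?thesis using block_row_less[of "w ! k'" g k' "Suc (length w)"] w k Suc
    by (auto simp: shift_row_def simp del: mult_Suc_right)
qed

lemma shift_row_inj: "inj_on (shift_row w) {..<Suc (length w)}"
proof (rule inj_onI)
  fix k l assume kl: "k \<in> {..<Suc (length w)}" "l \<in> {..<Suc (length w)}" and eq: "shift_row w k = shift_row w l"
  have *: "shift_row w k mod Suc (length w) = (if k = 0 then length w else k - 1)"
    if "k \<in> {..<Suc (length w)}" for k
    using that by (cases k) (simp_all add: shift_row_def del: mult_Suc_right)
  have "(if k = 0 then length w else k - 1) = (if l = 0 then length w else l - 1)"
    using *[OF kl(1)] *[OF kl(2)] unfolding eq by (rule trans[OF sym])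
  then show "k = l" using kl by (cases k; cases l) auto
qed

text \<open>
  Distinct basis vectors are sent to distinct basis vectors, so the cyclic shift preserves norms.
\<close>

lemma op_norm_cyclic_shift_le:
  assumes w: "set w \<subseteq> {..<g}" "g > 0"
  shows "op_norm (cyclic_shift g w) \<le> 1"
proof (rule op_norm_leI)
  let ?N = "Suc (length w)" let ?X = "cyclic_shift g w"
  fix v assume v: "v \<in> carrier_vec (dim_col ?X)" "l2_norm_vec v \<le> 1"
  have vN: "dim_vec v = ?N" using v by (simp add: cyclic_shift_def)
  have ent: "(?X *\<^sub>v v) $ r = (\<Sum>k<?N. if r = shift_row w k then v $ k else 0)" if r: "r < g * ?N" for r
  proof -
    have "(?X *\<^sub>v v) $ r = (\<Sum>k<?N. ?X $$ (r, k) * v $ k)"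
      using mult_mat_vec_entry[of r ?X v] v r by (simp add: cyclic_shift_def)
    also have "\<dots> = (\<Sum>k<?N. if r = shift_row w k then v $ k else 0)"
      using r by (intro sum.cong) (auto simp: cyclic_shift_def)
    finally show ?thesis .
  qed
  have ent1: "(?X *\<^sub>v v) $ shift_row w k = v $ k" if k: "k < ?N" for k
  proof -
    have "(?X *\<^sub>v v) $ shift_row w k = (\<Sum>l<?N. if l = k then v $ l else 0)"
      unfolding ent[OF shift_row_less[OF w k]]
      using k shift_row_inj[of w] by (intro sum.cong refl) (auto simp: inj_on_def)
    also have "\<dots> = v $ k" using k by simp
    finally show ?thesis .
  qed
  have "(l2_norm_vec (?X *\<^sub>v v))\<^sup>2 = (\<Sum>r<g * ?N. (cmod ((?X *\<^sub>v v) $ r))\<^sup>2)"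
    unfolding l2_norm_vec_sq by (simp add: cyclic_shift_def)
  also have "\<dots> = (\<Sum>r\<in>shift_row w ` {..<?N}. (cmod ((?X *\<^sub>v v) $ r))\<^sup>2)"
  proof (rule sum.mono_neutral_right)
    show "\<forall>r\<in>{..<g * ?N} - shift_row w ` {..<?N}. (cmod ((?X *\<^sub>v v) $ r))\<^sup>2 = 0"
    proof
      fix r assume r: "r \<in> {..<g * ?N} - shift_row w ` {..<?N}"
      then have "(?X *\<^sub>v v) $ r = 0"
        using ent[of r] by (intro trans[OF ent] sum.neutral) auto
      then show "(cmod ((?X *\<^sub>v v) $ r))\<^sup>2 = 0" by simp
    qed
  qed (use shift_row_less[OF w] in auto)
  also have "\<dots> = (\<Sum>k<?N. (cmod (v $ k))\<^sup>2)"
    unfolding sum.reindex[OF shift_row_inj] o_def by (intro sum.cong refl) (use ent1 in simp)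
  also have "\<dots> = (l2_norm_vec v)\<^sup>2" unfolding l2_norm_vec_sq vN ..
  finally have "l2_norm_vec (?X *\<^sub>v v) = l2_norm_vec v"
    using l2_norm_vec_nonneg by (simp add: power2_eq_iff_nonneg)
  then show "l2_norm_vec (?X *\<^sub>v v) \<le> 1" using v by simp
qed

lemma cyclic_shift_entry:
  assumes "set w \<subseteq> {..<g}" "j < g" "q \<le> length w" "k < length w"
  shows "cyclic_shift g w $$ (j * Suc (length w) + q, Suc k) = (if j = w ! k \<and> q = k then 1 else 0)"
proof -
  let ?N = "Suc (length w)"
  have "j * ?N + q = w ! k * ?N + k \<longleftrightarrow> j = w ! k \<and> q = k"
  proof
    assume *: "j * ?N + q = w ! k * ?N + k"
    have "(j * ?N + q) div ?N = j" "(w ! k * ?N + k) div ?N = w ! k"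
         "(j * ?N + q) mod ?N = q" "(w ! k * ?N + k) mod ?N = k"
      using assms by (simp_all del: mult_Suc_right)
    with * show "j = w ! k \<and> q = k" by metis
  qed simp
  then show ?thesis
    using assms block_row_less[of j g q ?N] by (simp add: cyclic_shift_def shift_row_def del: mult_Suc_right)
qed

text \<open>
  A word \<open>u\<close> no longer than \<open>w\<close> moves \<open>e\<^sub>n\<close> down to \<open>e\<^bsub>n - length u\<^esub>\<close> if \<open>u\<close> is a final segment of \<open>w\<close>,
  and annihilates \<open>e\<^sub>n\<close> otherwise; the wrap-around \<open>e\<^sub>0 \<mapsto> e\<^sub>n\<close> is not reached within \<open>n\<close> steps.
\<close>

lemma word_eval_cyclic_shift:
  assumes w: "set w \<subseteq> {..<g}" and u: "set u \<subseteq> {..<g}" "length u \<le> length w" and q: "q \<le> length w"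
  shows "word_eval (Suc (length w)) (cyclic_shift g w) u $$ (q, length w)
    = (if q = length w - length u \<and> u = drop (length w - length u) w then 1 else 0)"
  using u q
proof (induction u arbitrary: q)
  case (Cons j u)
  let ?N = "Suc (length w)" let ?X = "cyclic_shift g w"
  define k where "k = length w - Suc (length u)"
  have len: "length w - length (j # u) = k" by (simp add: k_def)
  have k: "k < length w" "length w - length u = Suc k" using Cons.prems by (auto simp: k_def)
  have "word_eval ?N ?X (j # u) $$ (q, length w)
      = (\<Sum>s<?N. ?X $$ (j * ?N + q, s) * word_eval ?N ?X u $$ (s, length w))"
    using Cons.prems by (intro word_eval_Cons_entry) auto
  also have "\<dots> = (\<Sum>s<?N. if s = Suc k then ?X $$ (j * ?N + q, Suc k) *
      (if u = drop (Suc k) w then 1 else 0) else 0)"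
  proof (intro sum.cong refl)
    fix s assume "s \<in> {..<?N}"
    then have "word_eval ?N ?X u $$ (s, length w) = (if s = Suc k \<and> u = drop (Suc k) w then 1 else 0)"
      using Cons.IH[of s] Cons.prems k by auto
    then show "?X $$ (j * ?N + q, s) * word_eval ?N ?X u $$ (s, length w)
      = (if s = Suc k then ?X $$ (j * ?N + q, Suc k) * (if u = drop (Suc k) w then 1 else 0) else 0)"
      by simp
  qed
  also have "\<dots> = ?X $$ (j * ?N + q, Suc k) * (if u = drop (Suc k) w then 1 else 0)"
    using k by simp
  also have "?X $$ (j * ?N + q, Suc k) = (if j = w ! k \<and> q = k then 1 else 0)"
    using Cons.prems k by (intro cyclic_shift_entry w) auto
  finally show ?case
    unfolding len Cons_nth_drop_Suc[OF k(1), symmetric] by (auto simp del: word_eval.simps)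
qed auto

section \<open>NC ball maps fixing the origin\<close>

text \<open>
  An NC ball map \<open>h\<close> with \<open>h(0) = 0\<close>, from \<open>g\<close> variables to columns of height \<open>m\<close>, together with
  the coefficients \<open>a\<close> of a power series that represents it at the points of the ball of norm less than \<open>\<epsilon>\<close>.
\<close>

locale normalized_nc_ball_map =
  fixes g m :: nat and h :: "complex mat \<Rightarrow> complex mat"
    and a :: "nat list \<Rightarrow> complex mat" and \<epsilon> :: real
  assumes ball_map: "nc_ball_map g m h"
    and vanishes: "vanishes_at_0 g m h"
    and g_pos: "g > 0"
    and eps: "\<epsilon> > 0"
    and a_carrier: "a w \<in> carrier_mat m 1"
    and series: "\<And>N X i j. N > 0 \<Longrightarrow> X \<in> int_nc_ball g 1 N \<Longrightarrow> op_norm X < \<epsilon> \<Longrightarrow> i < m * N \<Longrightarrow> j < N \<Longrightarrow>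
      (\<lambda>\<alpha>. \<Sum>w\<in>words g \<alpha>. kron (a w) (word_eval N X w) $$ (i, j)) sums (h X $$ (i, j))"
begin

abbreviation M :: "complex mat" where "M \<equiv> linear_coeff m g a"

lemma h_in_nc_ball: "N > 0 \<Longrightarrow> X \<in> int_nc_ball g 1 N \<Longrightarrow> h X \<in> nc_ball m 1 N"
  using ball_map unfolding nc_ball_map_def by blast

context
  fixes N :: nat and X :: "complex mat" and i j :: nat
  assumes N: "N > 0" and X: "X \<in> block_mats g 1 N" and X1: "op_norm X \<le> 1"
    and i: "i < m * N" and j: "j < N"
begin

lemma ray_holomorphic: "(\<lambda>u. h (u \<cdot>\<^sub>m X) $$ (i, j)) holomorphic_on ball 0 1"
  using ball_map i j N X X1 by (intro nc_analytic_ray_holomorphic[of g m 1 h N]) (auto simp: nc_ball_map_def)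

lemma ray_has_fps_expansion:
  "(\<lambda>u. h (u \<cdot>\<^sub>m X) $$ (i, j)) has_fps_expansion Abs_fps (\<lambda>\<alpha>. homogeneous_entry g a N X \<alpha> i j)"
proof (rule has_fps_expansionI)
  have "(\<lambda>\<alpha>. homogeneous_entry g a N X \<alpha> i j * u ^ \<alpha>) sums (h (u \<cdot>\<^sub>m X) $$ (i, j))"
    if u: "u \<in> ball 0 (min \<epsilon> 1)" for u
  proof -
    have "op_norm (u \<cdot>\<^sub>m X) \<le> cmod u * op_norm X" by (rule op_norm_smult_le)
    also have "\<dots> \<le> cmod u * 1" using X1 by (intro mult_left_mono) auto
    finally have "op_norm (u \<cdot>\<^sub>m X) < \<epsilon>" using u by simp
    then have *: "(\<lambda>\<alpha>. \<Sum>w\<in>words g \<alpha>. kron (a w) (word_eval N (u \<cdot>\<^sub>m X) w) $$ (i, j)) sums (h (u \<cdot>\<^sub>m X) $$ (i, j))"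
      using u by (intro series N smult_in_int_nc_ball X X1 i j) auto
    have "(\<Sum>w\<in>words g \<alpha>. kron (a w) (word_eval N (u \<cdot>\<^sub>m X) w) $$ (i, j))
        = homogeneous_entry g a N X \<alpha> i j * u ^ \<alpha>" for \<alpha>
      unfolding homogeneous_entry_def sum_distrib_right
    proof (rule sum.cong[OF refl])
      fix w assume "w \<in> words g \<alpha>"
      then have w: "set w \<subseteq> {..<g}" "length w = \<alpha>" by (auto simp: words_def)
      have "kron (a w) (word_eval N (u \<cdot>\<^sub>m X) w) $$ (i, j)
          = a w $$ (i div N, 0) * word_eval N (u \<cdot>\<^sub>m X) w $$ (i mod N, j)"
        by (intro kron_square_entry[OF a_carrier] word_eval_carrier i j)
      also have "word_eval N (u \<cdot>\<^sub>m X) w $$ (i mod N, j) = u ^ \<alpha> * word_eval N X w $$ (i mod N, j)"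
        using word_eval_smult[of X g N w "i mod N" j u] X w N j by (simp add: block_mats_def)
      finally show "kron (a w) (word_eval N (u \<cdot>\<^sub>m X) w) $$ (i, j)
          = a w $$ (i div N, 0) * word_eval N X w $$ (i mod N, j) * u ^ \<alpha>" by simp
    qed
    with * show ?thesis by simp
  qed
  then show "\<forall>\<^sub>F u in nhds 0. (\<lambda>n. fps_nth (Abs_fps (\<lambda>\<alpha>. homogeneous_entry g a N X \<alpha> i j)) n * u ^ n)
      sums (h (u \<cdot>\<^sub>m X) $$ (i, j))"
    using eps eventually_nhds_in_open[of "ball (0::complex) (min \<epsilon> 1)" 0]
    by (auto elim!: eventually_mono)
qed

lemma h_0_entry: "h (0 \<cdot>\<^sub>m X) $$ (i, j) = 0"
proof -
  have "0 \<cdot>\<^sub>m X = 0\<^sub>m (g * N) N" using X by (auto simp: block_mats_def)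
  then show ?thesis using vanishes N i j by (simp add: vanishes_at_0_def)
qed

lemma homogeneous_entry_0: "homogeneous_entry g a N X 0 i j = 0"
  using fps_nth_fps_expansion[OF ray_has_fps_expansion, of 0] h_0_entry by simp

lemma deriv_ray: "deriv (\<lambda>u. h (u \<cdot>\<^sub>m X) $$ (i, j)) 0 = (kron M (1\<^sub>m N) * X) $$ (i, j)"
  using fps_nth_fps_expansion[OF ray_has_fps_expansion, of 1] homogeneous_entry_1[of X g N i m j a] X i j
  by (simp add: block_mats_def)

text \<open>
  An entry of \<open>u \<mapsto> h(u X)\<close> is linear on the whole disc exactly if its homogeneous parts of degree at
  least \<open>2\<close> vanish at \<open>X\<close>. The passage from the power series near \<open>0\<close> to the disc is the
  identity theorem.
\<close>

lemma ray_linear_iff: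
  "(\<forall>u\<in>ball 0 1. h (u \<cdot>\<^sub>m X) $$ (i, j) = (kron M (1\<^sub>m N) * X) $$ (i, j) * u)
    \<longleftrightarrow> (\<forall>\<alpha>\<ge>2. homogeneous_entry g a N X \<alpha> i j = 0)"
proof -
  define c where "c = (kron M (1\<^sub>m N) * X) $$ (i, j)"
  define F where "F = Abs_fps (\<lambda>\<alpha>. homogeneous_entry g a N X \<alpha> i j)"
  have F: "fps_nth F 0 = 0" "fps_nth F 1 = c"
    using homogeneous_entry_0 homogeneous_entry_1[of X g N i m j a] X i j
    by (simp_all add: F_def c_def block_mats_def)
  have 1: "(\<forall>\<alpha>\<ge>2. homogeneous_entry g a N X \<alpha> i j = 0) \<longleftrightarrow> F - fps_const c * fps_X = 0"
  proof -
    have nth: "fps_nth (F - fps_const c * fps_X) \<alpha> = fps_nth F \<alpha> - (if \<alpha> = 1 then c else 0)" for \<alpha>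
      by simp
    have "(F - fps_const c * fps_X = 0) \<longleftrightarrow> (\<forall>\<alpha>. fps_nth F \<alpha> = (if \<alpha> = 1 then c else 0))"
      unfolding fps_eq_iff nth by simp
    also have "\<dots> \<longleftrightarrow> (\<forall>\<alpha>\<ge>2. fps_nth F \<alpha> = 0)"
    proof safe
      fix \<alpha> assume "\<forall>\<alpha>\<ge>2. fps_nth F \<alpha> = 0"
      then show "fps_nth F \<alpha> = (if \<alpha> = 1 then c else 0)"
        using F by (cases "\<alpha> \<ge> 2"; cases "\<alpha> = 0") (auto simp: not_le less_2_cases_iff)
    qed auto
    finally show ?thesis by (simp add: F_def)
  qed
  have exp: "(\<lambda>u. h (u \<cdot>\<^sub>m X) $$ (i, j) - c * u) has_fps_expansion F - fps_const c * fps_X"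
    using ray_has_fps_expansion unfolding F_def by (intro fps_expansion_intros)
  show ?thesis
    unfolding 1 c_def[symmetric]
  proof
    assume lin: "\<forall>u\<in>ball 0 1. h (u \<cdot>\<^sub>m X) $$ (i, j) = c * u"
    have "\<forall>\<^sub>F u in nhds (0::complex). u \<in> ball 0 1" by (intro eventually_nhds_in_open) auto
    then have "\<forall>\<^sub>F u in nhds 0. h (u \<cdot>\<^sub>m X) $$ (i, j) - c * u = 0"
      by eventually_elim (use lin in auto)
    then have "(\<lambda>u. h (u \<cdot>\<^sub>m X) $$ (i, j) - c * u) has_fps_expansion 0"
      by (auto simp: has_fps_expansion_def elim!: eventually_mono)
    then show "F - fps_const c * fps_X = 0" by (rule fps_expansion_unique_complex[OF exp])
  next
    assume "F - fps_const c * fps_X = 0"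
    with exp have 0: "(\<lambda>u. h (u \<cdot>\<^sub>m X) $$ (i, j) - c * u) has_fps_expansion 0" by simp
    show "\<forall>u\<in>ball 0 1. h (u \<cdot>\<^sub>m X) $$ (i, j) = c * u"
    proof
      fix u :: complex assume u: "u \<in> ball 0 1"
      have "h (u \<cdot>\<^sub>m X) $$ (i, j) - c * u = 0"
        by (rule has_fps_expansion_0_analytic_continuation[OF 0, of "ball 0 1"])
          (use u in \<open>auto intro!: holomorphic_intros ray_holomorphic\<close>)
      then show "h (u \<cdot>\<^sub>m X) $$ (i, j) = c * u" by simp
    qed
  qed
qed

end

text \<open>
  The only use of the boundary condition, at the nilpotent points \<open>v \<otimes> E\<^sub>1\<^sub>2\<close>.
\<close>

lemma norm_linear_coeff_mult:
  assumes v: "v \<in> carrier_vec g" and v1: "l2_norm_vec v = 1"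
  shows "l2_norm_vec (M *\<^sub>v v) = 1"
proof -
  define X where "X = mat (g * 2) 2 (\<lambda>(r, k). if k = 1 \<and> even r then v $ (r div 2) else 0)"
  have X: "X \<in> carrier_mat (g * 2) 2" by (simp add: X_def)
  then have Xb: "X \<in> block_mats g 1 2" by (simp add: block_mats_def)
  have Xent: "X $$ (l * 2 + q, k) = (if k = 1 \<and> q = 0 then v $ l else 0)" if "l < g" "q < 2" "k < 2" for l q k
    using that block_row_less[of l g q 2] by (auto simp: X_def less_2_cases_iff)
  have "op_norm X = L2_set (\<lambda>r. cmod (X $$ (r, 1))) {..<g * 2}"
    using op_norm_single_column[of 1 X] by (simp add: X_def)
  also have "\<dots> = L2_set (\<lambda>l. cmod (X $$ (l * 2 + 0, 1))) {..<g}"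
    by (rule L2_set_one_row_per_block) (simp_all add: Xent)
  also have "\<dots> = l2_norm_vec v"
    unfolding l2_norm_vec_def using v by (intro L2_set_cong) (simp_all add: Xent[where q = 0, simplified])
  finally have X1: "op_norm X = 1" using v1 by simp
  define L where "L = kron M (1\<^sub>m 2) * X"
  have Lc: "L \<in> carrier_mat (m * 2) 2" unfolding L_def by (rule mult_carrier_mat[OF kron_id_carrier[OF linear_coeff_carrier] X])
  have Lent: "L $$ (p * 2 + q, k) = (if k = 1 \<and> q = 0 then (M *\<^sub>v v) $ p else 0)"
    if "p < m" "q < 2" "k < 2" for p q k
  proof -
    have "L $$ (p * 2 + q, k) = (\<Sum>l<g. M $$ (p, l) * X $$ (l * 2 + q, k))"
      unfolding L_def using kron_id_mult_entry[OF linear_coeff_carrier X, of "p * 2 + q" m k a] that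
        block_row_less[of p m q 2] by simp
    also have "\<dots> = (if k = 1 \<and> q = 0 then \<Sum>l<g. M $$ (p, l) * v $ l else 0)"
      using that by (auto simp: Xent intro!: sum.neutral)
    finally show ?thesis
      using mult_mat_vec_entry[of p M v] that v by (simp add: linear_coeff_def)
  qed
  have Lent': "L $$ (r, 0) = 0" if "r < m * 2" for r
    using Lent[of "r div 2" "r mod 2" 0] that by (simp add: less_mult_imp_div_less)
  \<comment> \<open>the second row of every component of \<open>X\<close> is zero, and so is its first column\<close>
  have row1: "word_eval 2 X w $$ (1, k) = 0" if "w \<noteq> []" "set w \<subseteq> {..<g}" "k < 2" for w k
    using that by (cases w)
      (auto simp: word_eval_Cons_entry Xent[where q = 1, simplified] simp del: word_eval.simps intro!: sum.neutral)
  have nil: "word_eval 2 X w $$ (q, k) = 0" if w: "w \<in> words g \<alpha>" "\<alpha> \<ge> 2" and qk: "q < 2" "k < 2" for w \<alpha> q k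
  proof -
    obtain l1 l2 w' where [simp]: "w = l1 # l2 # w'"
      using w by (auto simp: words_def Suc_le_length_iff numeral_2_eq_2)
    have "l1 < g" "set (l2 # w') \<subseteq> {..<g}" using w by (auto simp: words_def)
    then show ?thesis
      using row1[of "l2 # w'" k] qk Xent[of l1 q]
      by (auto simp: word_eval_Cons_entry[of q 2 k X l1] less_2_cases_iff simp del: word_eval.simps
          intro!: sum.neutral)
  qed
  have lin: "h (u \<cdot>\<^sub>m X) $$ (i, j) = L $$ (i, j) * u" if "i < m * 2" "j < 2" "cmod u < 1" for i j u
  proof -
    have "\<forall>\<alpha>\<ge>2. homogeneous_entry g a 2 X \<alpha> i j = 0"
      unfolding homogeneous_entry_def using nil that by (auto intro!: sum.neutral)
    then show ?thesis
      using ray_linear_iff[of 2 X i j] Xb X1 that unfolding L_def by simp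
  qed
  have "mat_tendsto (m * 2) 2 (\<lambda>r::real. h ((of_real r * cis 0) \<cdot>\<^sub>m X)) L (at_left 1)"
    unfolding mat_tendsto_def
  proof (intro allI impI)
    fix i j assume ij: "i < m * 2" "j < (2::nat)"
    have "((\<lambda>r. L $$ (i, j) * of_real r) \<longlongrightarrow> L $$ (i, j) * of_real 1) (at_left (1::real))"
      by (intro tendsto_intros)
    moreover have "\<forall>\<^sub>F r in at_left (1::real). r \<in> {-1<..<1}"
      by (rule eventually_at_left_real) simp
    then have "\<forall>\<^sub>F r in at_left (1::real). L $$ (i, j) * of_real r = h ((of_real r * cis 0) \<cdot>\<^sub>m X) $$ (i, j)"
      by eventually_elim (use ij in \<open>simp add: lin abs_less_iff\<close>)
    ultimately show "((\<lambda>r. h ((of_real r * cis 0) \<cdot>\<^sub>m X) $$ (i, j)) \<longlongrightarrow> L $$ (i, j)) (at_left (1::real))"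
      by (auto elim: Lim_transform_eventually)
  qed
  moreover have "L \<in> block_mats m 1 2" using Lc by (simp add: block_mats_def)
  ultimately have "op_norm L = 1"
    using ball_map Xb X1 unfolding nc_ball_map_def by (metis zero_less_numeral)
  moreover have "op_norm L = L2_set (\<lambda>r. cmod (L $$ (r, 1))) {..<m * 2}"
    using op_norm_single_column[of 1 L] Lc Lent' by (auto simp: less_2_cases_iff)
  moreover have "\<dots> = L2_set (\<lambda>p. cmod (L $$ (p * 2 + 0, 1))) {..<m}"
    by (rule L2_set_one_row_per_block) (simp_all add: Lent)
  moreover have "\<dots> = l2_norm_vec (M *\<^sub>v v)"
    unfolding l2_norm_vec_def by (intro L2_set_cong)
      (simp_all add: Lent[where q = 0, simplified] linear_coeff_def del: index_mult_mat_vec)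
  ultimately show ?thesis by simp
qed

lemma isometry_linear_coeff: "isometry_mat M"
  unfolding isometry_mat_def
proof
  fix v :: "complex vec" assume "v \<in> carrier_vec (dim_col M)"
  then have v: "v \<in> carrier_vec g" by (simp add: linear_coeff_def)
  define s where "s = l2_norm_vec v"
  show "l2_norm_vec (M *\<^sub>v v) = l2_norm_vec v"
  proof (cases "s = 0")
    case True
    then have "v = 0\<^sub>v g" using l2_norm_vec_eq_0_iff[of v] v by (simp add: s_def)
    then have "M *\<^sub>v v = 0\<^sub>v m"
      by (intro eq_vecI) (simp_all add: mult_mat_vec_entry linear_coeff_def del: index_mult_mat_vec)
    then show ?thesis using True l2_norm_vec_eq_0_iff[of "0\<^sub>v m"] by (simp add: s_def)
  next
    case False
    then have s: "s > 0" using l2_norm_vec_nonneg[of v] by (simp add: s_def)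
    define w where "w = of_real (inverse s) \<cdot>\<^sub>v v"
    have "l2_norm_vec w = 1" unfolding w_def l2_norm_vec_smult s_def[symmetric] using s by (simp add: norm_inverse)
    then have "l2_norm_vec (M *\<^sub>v w) = 1"
      using v by (intro norm_linear_coeff_mult) (simp_all add: w_def)
    also have "M *\<^sub>v w = of_real (inverse s) \<cdot>\<^sub>v (M *\<^sub>v v)"
      unfolding w_def by (rule mult_mat_vec[OF linear_coeff_carrier v])
    finally have "inverse s * l2_norm_vec (M *\<^sub>v v) = 1"
      unfolding l2_norm_vec_smult using s by (simp add: norm_inverse)
    then show ?thesis using s unfolding s_def[symmetric] by (simp add: field_simps)
  qed
qed

text \<open>
  The coefficients of degree at least \<open>2\<close> vanish, by the vector-valued Schwarz lemma applied to the
  last column of \<open>h(u X)\<close>, where \<open>X\<close> is the cyclic shift of \<open>w\<close>.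
\<close>

lemma coeff_eq_0:
  assumes w: "set w \<subseteq> {..<g}" "length w \<ge> 2" and p: "p < m"
  shows "a w $$ (p, 0) = 0"
proof -
  define n where "n = length w"
  define N where "N = Suc n"
  define X where "X = cyclic_shift g w"
  \<comment> \<open>index of the last letter of \<open>w\<close>, the one whose component acts on \<open>e\<^sub>n\<close>\<close>
  define k where "k = n - 1"
  have n: "n = Suc k" "k < length w" using w by (simp_all add: n_def k_def)
  have N0: "N > 0" "n < N" by (simp_all add: N_def)
  have X: "X \<in> carrier_mat (g * N) N" using cyclic_shift_carrier[of g w] by (simp add: X_def N_def n_def)
  then have Xb: "X \<in> block_mats g 1 N" by (simp add: block_mats_def)
  have X1: "op_norm X \<le> 1" unfolding X_def by (rule op_norm_cyclic_shift_le[OF w(1) g_pos])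
  have wk: "w ! k < g" using subsetD[OF w(1) nth_mem[OF n(2)]] by simp
  define F where "F i u = h (u \<cdot>\<^sub>m X) $$ (i, n)" for i u
  define c where "c i = (kron M (1\<^sub>m N) * X) $$ (i, n)" for i
  have c: "c (p * N + q) = (if q = k then M $$ (p, w ! k) else 0)" if "p < m" "q < N" for p q
  proof -
    have "c (p * N + q) = (\<Sum>l<g. M $$ (p, l) * X $$ (l * N + q, n))"
      unfolding c_def using kron_id_mult_entry[OF linear_coeff_carrier X, of "p * N + q" m n a] that
        block_row_less[of p m q N] N0 by simp
    also have "\<dots> = (\<Sum>l<g. if l = w ! k then if q = k then M $$ (p, l) else 0 else 0)"
    proof (rule sum.cong[OF refl])
      fix l assume "l \<in> {..<g}"
      then have "X $$ (l * N + q, n) = (if l = w ! k \<and> q = k then 1 else 0)"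
        using cyclic_shift_entry[OF w(1), of l q k] n that unfolding X_def N_def n_def by simp
      then show "M $$ (p, l) * X $$ (l * N + q, n) = (if l = w ! k then if q = k then M $$ (p, l) else 0 else 0)"
        by simp
    qed
    also have "\<dots> = (if q = k then M $$ (p, w ! k) else 0)" using wk by simp
    finally show ?thesis .
  qed
  have dF: "deriv (F i) 0 = c i" if "i < m * N" for i
    unfolding F_def c_def by (rule deriv_ray[OF N0(1) Xb X1 that N0(2)])
  have lin: "F i u = c i * u" if i: "i < m * N" and u: "cmod u < 1" for i u
  proof -
    have "F i u = deriv (F i) 0 * u"
    proof (rule schwarz_lemma_vector[where I = "{..<m * N}"])
      show "F i holomorphic_on ball 0 1" if "i \<in> {..<m * N}" for i
        unfolding F_def using that by (intro ray_holomorphic[OF N0(1) Xb X1]) (simp_all add: N0)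
      show "F i 0 = 0" if "i \<in> {..<m * N}" for i
        unfolding F_def using that by (intro h_0_entry[OF N0(1) Xb X1]) (simp_all add: N0)
      show "L2_set (\<lambda>i. cmod (F i z)) {..<m * N} \<le> 1" if "cmod z < 1" for z
      proof -
        have "h (z \<cdot>\<^sub>m X) \<in> nc_ball m 1 N"
          by (intro h_in_nc_ball N0 smult_in_int_nc_ball Xb X1 that)
        then show ?thesis
          using column_norm_le_op_norm[of n "h (z \<cdot>\<^sub>m X)"] N0
          by (auto simp: F_def nc_ball_def block_mats_def)
      qed
      have "L2_set (\<lambda>i. cmod (deriv (F i) 0)) {..<m * N} = L2_set (\<lambda>i. cmod (c i)) {..<m * N}"
        by (intro L2_set_cong) (simp_all add: dF)
      also have "\<dots> = L2_set (\<lambda>p. cmod (c (p * N + k))) {..<m}"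
        by (rule L2_set_one_row_per_block) (use n N0 c in auto)
      also have "\<dots> = L2_set (\<lambda>p. cmod ((M *\<^sub>v unit_vec g (w ! k)) $ p)) {..<m}"
        using n N0 c wk by (intro L2_set_cong) (auto simp: linear_coeff_def)
      also have "\<dots> = l2_norm_vec (M *\<^sub>v unit_vec g (w ! k))"
        unfolding l2_norm_vec_def by (simp add: linear_coeff_def)
      also have "\<dots> = 1"
        using wk by (intro norm_linear_coeff_mult) (simp_all add: l2_norm_unit_vec)
      finally show "L2_set (\<lambda>i. cmod (deriv (F i) 0)) {..<m * N} = 1" .
    qed (use i u in auto)
    then show ?thesis by (simp add: dF i)
  qed
  \<comment> \<open>row \<open>p * N\<close> is the component along \<open>e\<^sub>0\<close> in block \<open>p\<close>\<close>
  have pN: "p * N < m * N" using p N0 by simp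
  then have "homogeneous_entry g a N X n (p * N) n = 0"
    using ray_linear_iff[OF N0(1) Xb X1 pN N0(2)] lin[OF pN] w by (auto simp: F_def c_def n_def)
  moreover have "homogeneous_entry g a N X n (p * N) n = (\<Sum>u\<in>words g n. if u = w then a u $$ (p, 0) else 0)"
    unfolding homogeneous_entry_def
  proof (rule sum.cong[OF refl])
    fix u assume "u \<in> words g n"
    then have u: "set u \<subseteq> {..<g}" "length u = length w" by (auto simp: words_def n_def)
    have "word_eval N X u $$ (0, n) = (if u = w then 1 else 0)"
      using word_eval_cyclic_shift[OF w(1) u(1), of 0] u unfolding N_def X_def n_def by simp
    then show "a u $$ (p * N div N, 0) * word_eval N X u $$ (p * N mod N, n)
        = (if u = w then a u $$ (p, 0) else 0)"
      using N0 by simp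
  qed
  moreover have "finite (words g n)" "w \<in> words g n"
    using finite_lists_length_eq[of "{..<g}" n] w by (simp_all add: words_def n_def)
  ultimately show ?thesis by simp
qed

lemma h_eq_linear:
  assumes N: "N > 0" and X: "X \<in> int_nc_ball g 1 N"
  shows "h X = kron M (1\<^sub>m N) * X"
proof (rule eq_matI)
  have Xc: "X \<in> carrier_mat (g * N) N" using X by (simp add: int_nc_ball_def block_mats_def)
  have "op_norm X < 1" using X by (simp add: int_nc_ball_def)
  then obtain r where r: "op_norm X < r" "r < 1" using dense by blast
  then have r0: "r > 0" using op_norm_nonneg[of X] by simp
  \<comment> \<open>\<open>X = r Y\<close> with \<open>\<parallel>Y\<parallel> \<le> 1\<close> and \<open>r < 1\<close>, so that \<open>X\<close> lies on the disc \<open>u \<mapsto> u Y\<close>\<close>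
  define Y where "Y = of_real (inverse r) \<cdot>\<^sub>m X"
  have Yc: "Y \<in> carrier_mat (g * N) N" using Xc by (simp add: Y_def)
  have Yb: "Y \<in> block_mats g 1 N" using Yc by (simp add: block_mats_def)
  have "op_norm Y \<le> inverse r * op_norm X"
    unfolding Y_def using op_norm_smult_le[of "of_real (inverse r)" X] r0 by (simp add: norm_inverse)
  also have "\<dots> \<le> 1" using r r0 by (simp add: field_simps)
  finally have Y1: "op_norm Y \<le> 1" .
  have XY: "X = of_real r \<cdot>\<^sub>m Y" using r0 by (auto simp: Y_def)
  have hX: "h X \<in> carrier_mat (m * N) N"
    using h_in_nc_ball[OF N X] by (simp add: nc_ball_def block_mats_def)
  show "dim_row (h X) = dim_row (kron M (1\<^sub>m N) * X)" "dim_col (h X) = dim_col (kron M (1\<^sub>m N) * X)"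
    using hX Xc by (auto simp: kron_def linear_coeff_def)
  fix i j assume "i < dim_row (kron M (1\<^sub>m N) * X)" "j < dim_col (kron M (1\<^sub>m N) * X)"
  then have i: "i < m * N" and j: "j < N" using Xc by (auto simp: kron_def linear_coeff_def)
  have "a w $$ (i div N, 0) = 0" if "w \<in> words g \<alpha>" "\<alpha> \<ge> 2" for w \<alpha>
    using that i by (intro coeff_eq_0) (auto simp: words_def less_mult_imp_div_less)
  then have "\<forall>\<alpha>\<ge>2. homogeneous_entry g a N Y \<alpha> i j = 0"
    unfolding homogeneous_entry_def by (auto intro!: sum.neutral)
  then have "\<forall>u\<in>ball 0 1. h (u \<cdot>\<^sub>m Y) $$ (i, j) = (kron M (1\<^sub>m N) * Y) $$ (i, j) * u"
    using ray_linear_iff[OF N Yb Y1 i j] by blast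
  then have "h X $$ (i, j) = (kron M (1\<^sub>m N) * Y) $$ (i, j) * of_real r"
    using r r0 by (subst XY) simp
  also have "\<dots> = (kron M (1\<^sub>m N) * X) $$ (i, j)"
  proof -
    have "kron M (1\<^sub>m N) \<in> carrier_mat (m * N) (g * N)" by (rule kron_id_carrier[OF linear_coeff_carrier])
    from mult_smult_distrib[OF this Yc, of "of_real r"] have "kron M (1\<^sub>m N) * X = of_real r \<cdot>\<^sub>m (kron M (1\<^sub>m N) * Y)"
      unfolding XY[symmetric] .
    moreover have "i < dim_row (kron M (1\<^sub>m N) * Y)" "j < dim_col (kron M (1\<^sub>m N) * Y)"
      using i j Yc by (auto simp: kron_def linear_coeff_def)
    ultimately show ?thesis by (simp del: index_mult_mat)
  qed
  finally show "h X $$ (i, j) = (kron M (1\<^sub>m N) * X) $$ (i, j)" .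
qed

end

lemma normalized_nc_ball_map_obtain:
  assumes "nc_ball_map g m h" "vanishes_at_0 g m h" "g > 0"
  obtains a \<epsilon> where "normalized_nc_ball_map g m h a \<epsilon>"
proof -
  have "nc_power_series_at_0 g m 1 h"
    using assms(1) by (simp add: nc_ball_map_def nc_analytic_def)
  then obtain a \<epsilon> where "\<epsilon> > 0" "\<forall>w. a w \<in> carrier_mat m 1"
    "\<forall>N>0. \<forall>X\<in>int_nc_ball g 1 N. op_norm X < \<epsilon> \<longrightarrow>
           (\<forall>i<m * N. \<forall>j<1 * N.
              (\<lambda>\<alpha>. \<Sum>w\<in>words g \<alpha>. kron (a w) (word_eval N X w) $$ (i, j)) sums (h X $$ (i, j)))"
    unfolding nc_power_series_at_0_def by blast
  then have "normalized_nc_ball_map g m h a \<epsilon>"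
    using assms by unfold_locales auto
  then show ?thesis by (rule that)
qed

theorem corollary1p4:
  fixes g' d' :: nat
  assumes "g' \<ge> 1" and "d' \<ge> 1"
  shows "(\<forall>h. nc_ball_map g' d' h \<and> vanishes_at_0 g' d' h \<longrightarrow>
            linear_on_ball g' h \<and>
            (\<exists>!M. M \<in> carrier_mat d' g' \<and> isometry_mat M \<and>
                  (\<forall>N>0. \<forall>X\<in>int_nc_ball g' 1 N. h X = kron M (1\<^sub>m N) * X)))
         \<and> (d' < g' \<longrightarrow> \<not> (\<exists>h. nc_ball_map g' d' h \<and> vanishes_at_0 g' d' h))"
proof -
  have ex: "\<exists>M\<in>carrier_mat d' g'. isometry_mat M \<and>
      (\<forall>N>0. \<forall>X\<in>int_nc_ball g' 1 N. h X = kron M (1\<^sub>m N) * X)"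
    if "nc_ball_map g' d' h" "vanishes_at_0 g' d' h" for h
  proof -
    from that assms obtain a \<epsilon> where "normalized_nc_ball_map g' d' h a \<epsilon>"
      by (auto elim: normalized_nc_ball_map_obtain)
    then interpret normalized_nc_ball_map g' d' h a \<epsilon> .
    show ?thesis
      using isometry_linear_coeff h_eq_linear linear_coeff_carrier by blast
  qed
  show ?thesis
  proof (intro conjI allI impI)
    fix h assume h: "nc_ball_map g' d' h \<and> vanishes_at_0 g' d' h"
    from ex[of h] h obtain M where M: "M \<in> carrier_mat d' g'" "isometry_mat M"
      and hM: "\<And>N X. N > 0 \<Longrightarrow> X \<in> int_nc_ball g' 1 N \<Longrightarrow> h X = kron M (1\<^sub>m N) * X" by blast
    show "linear_on_ball g' h" using M(1) hM by (rule linear_on_ball_kron)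
    show "\<exists>!M. M \<in> carrier_mat d' g' \<and> isometry_mat M \<and>
        (\<forall>N>0. \<forall>X\<in>int_nc_ball g' 1 N. h X = kron M (1\<^sub>m N) * X)"
    proof (rule ex1I[of _ M])
      fix M' assume M': "M' \<in> carrier_mat d' g' \<and> isometry_mat M' \<and>
        (\<forall>N>0. \<forall>X\<in>int_nc_ball g' 1 N. h X = kron M' (1\<^sub>m N) * X)"
      then have M'c: "M' \<in> carrier_mat d' g'"
        and hM': "\<And>N X. N > 0 \<Longrightarrow> X \<in> int_nc_ball g' 1 N \<Longrightarrow> h X = kron M' (1\<^sub>m N) * X"
        by blast+
      show "M' = M"
      proof (rule kron_linear_unique[OF M'c M(1)])
        fix X assume "X \<in> int_nc_ball g' 1 1"
        then show "kron M' (1\<^sub>m 1) * X = kron M (1\<^sub>m 1) * X"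
          using hM[of 1 X] hM'[of 1 X] by simp
      qed
    qed (use M hM in auto)
  next
    assume "d' < g'"
    show "\<not> (\<exists>h. nc_ball_map g' d' h \<and> vanishes_at_0 g' d' h)"
    proof (intro notI)
      assume "\<exists>h. nc_ball_map g' d' h \<and> vanishes_at_0 g' d' h"
      then obtain h where "nc_ball_map g' d' h" "vanishes_at_0 g' d' h" by blast
      from ex[OF this] obtain M where "M \<in> carrier_mat d' g'" "isometry_mat M" by blast
      then have "g' \<le> d'" by (rule isometry_mat_imp_le)
      with \<open>d' < g'\<close> show False by simp
    qed
  qed
qed

end
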